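(* Let $n\ge1$ and $\kappa\ge1$. Every polynomial ${\sf P}={\sf P}(j^\kappa f)\in E_{\kappa,m}^n$ invariant by reparametrization of weight $m$ can be written in the form $${\sf P}(j^\kappa f)=\sum_{-\frac{\kappa-1}{\kappa}m\le a\le m}(f_1')^a\,{\sf P}_a\Big(f_i',\ \Lambda_{1,i}^3,\ \Lambda_{1,i;1}^5,\ \dots,\ \Lambda_{1,i;1^{\kappa-2}}^{2\kappa-1}\ :\ 2\le i\le n\Big),$$ where the integer $a$ runs through the (possibly negative) integers of $\big[-\frac{\kappa-1}{\kappa}m,m\big]$, and where each ${\sf P}_a\in\mathbb{C}[F_i,A_i^3,A_i^5,\dots,A_i^{2\kappa-1}:2\le i\le n]$ is weighted homogeneous of weighted degree $m-a$, i.e. $${\sf P}_a\big(\delta F_i,\delta^3A_i^3,\dots,\delta^{2\kappa-1}A_i^{2\kappa-1}\big)=\delta^{m-a}\,{\sf P}_a\big(F_i,A_i^3,\dots,A_i^{2\kappa-1}\big).$$ Conversely, for every collection of such weighted homogeneous polynomials ${\sf P}_a$ of weighted degree $m-a$, indexed by integers $a\in\big[-\frac{\kappa-1}{\kappa}m,m\big]$, such that the finite sum $${\sf R}(j^\kappa f)=\sum_{-\frac{\kappa-1}{\kappa}m\le a\le m}(f_1')^a\,{\sf P}_a\Big(f_i',\Lambda_{1,i}^3,\dots,\Lambda_{1,i;1^{\kappa-2}}^{2\kappa-1}:2\le i\le n\Big)$$ is, after reduction to a common denominator and simplification, a true polynomial in $\mathbb{C}[j^\kappa f]$, the polynomial ${\sf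 R}(j^\kappa f)$ is invariant by reparametrization and belongs to $E_{\kappa,m}^n$.
   Context: $\mathbb{C}[j^\kappa f]$ is the polynomial ring in the variables $f_i^{(\lambda)}$, $1\le i\le n$, $1\le\lambda\le\kappa$ (written $f_i',f_i'',\dots$), the jet coordinates of germs $f=(f_1,\dots,f_n):(\mathbb{C},0)\to\mathbb{C}^n$. A polynomial ${\sf P}$ is invariant by reparametrization of weight $m$ if ${\sf P}(j^\kappa(f\circ\phi))=(\phi')^m\,{\sf P}((j^\kappa f)\circ\phi)$ for all local biholomorphisms $\phi:(\mathbb{C},0)\to(\mathbb{C},0)$; $E_{\kappa,m}^n$ is the vector space of these. The total differentiation operator is ${\sf D}=\sum_{k=1}^n\sum_{\lambda}f_k^{(\lambda+1)}\,\partial/\partial f_k^{(\lambda)}$, and for invariants ${\sf P},{\sf Q}$ of weights $p,q$ the bracket is $[{\sf P},{\sf Q}]=q\,{\sf D}{\sf P}\cdot{\sf Q}-p\,{\sf P}\cdot{\sf D}{\sf Q}$ (an invariant of weight $p+q+1$). For $2\le i\le n$: $\Lambda_{1,i}^3=[f_i',f_1']$, and inductively $\Lambda_{1,i;1^{\lambda-2}}^{2\lambda-1}=[\Lambda_{1,i;1^{\lambda-3}}^{2\lambda-3},f_1']$ for $3\le\lambda\le\kappa$ (with $\Lambda_{1,i;1^0}^3=\Lambda_{1,i}^3$); the upper index is the weight, and $1^r$ stands for $r$ copies of the index $1$. *)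

theory Defs
  imports
    "HOL-Complex_Analysis.Complex_Analysis"
    "HOL-Computational_Algebra.Computational_Algebra"
    "HOL-Library.Poly_Mapping"
begin

section \<open>Complex polynomials in variables of an arbitrary type\<close>

text \<open>A monomial is a finitely supported exponent function.\<close>

type_synonym 'v cpoly = "('v \<Rightarrow>\<^sub>0 nat) \<Rightarrow>\<^sub>0 complex"

definition Const :: "complex \<Rightarrow> 'v cpoly" where
  "Const c = Poly_Mapping.single 0 c"

definition Var :: "'v \<Rightarrow> 'v cpoly" where
  "Var v = Poly_Mapping.single (Poly_Mapping.single v 1) 1"

definition polys_over :: "'v set \<Rightarrow> 'v cpoly set" where
  "polys_over V = {P. \<forall>\<mu>\<in>Poly_Mapping.keys P. Poly_Mapping.keys \<mu> \<subseteq> V}"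

text \<open>Substitution of \<open>\<sigma> v\<close> for each variable \<open>v\<close>, where \<open>c\<close> embeds the coefficients into the
  target ring.\<close>

definition subst_with :: "(complex \<Rightarrow> 'b) \<Rightarrow> ('v \<Rightarrow> 'b) \<Rightarrow> 'v cpoly \<Rightarrow> 'b :: comm_semiring_1" where
  "subst_with c \<sigma> P =
     (\<Sum>\<mu>\<in>Poly_Mapping.keys P. c (Poly_Mapping.lookup P \<mu>) *
        (\<Prod>v\<in>Poly_Mapping.keys \<mu>. \<sigma> v ^ Poly_Mapping.lookup \<mu> v))"

definition eval_at :: "('v \<Rightarrow> complex) \<Rightarrow> 'v cpoly \<Rightarrow> complex" where
  "eval_at = subst_with (\<lambda>c. c)"

definition subst :: "('v \<Rightarrow> 'w cpoly) \<Rightarrow> 'v cpoly \<Rightarrow> 'w cpoly" where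
  "subst = subst_with Const"

definition partial_deriv :: "'v \<Rightarrow> 'v cpoly \<Rightarrow> 'v cpoly" where
  "partial_deriv v P =
     (\<Sum>\<mu>\<in>Poly_Mapping.keys P.
        Poly_Mapping.single (\<mu> - Poly_Mapping.single v 1)
          (of_nat (Poly_Mapping.lookup \<mu> v) * Poly_Mapping.lookup P \<mu>))"


section \<open>Jet coordinates\<close>

text \<open>\<open>Jet i l\<close> is the coordinate \<open>f_i^(l)\<close>. The linear order serves only to make the polynomial
  ring an instance of \<^class>\<open>idom\<close>, so that its fraction field is available.\<close>

datatype jet_var = Jet (jet_index: nat) (jet_order: nat)

instantiation jet_var :: linorder
begin

definition less_eq_jet_var :: "jet_var \<Rightarrow> jet_var \<Rightarrow> bool" where
  "v \<le> w \<longleftrightarrow> jet_index v < jet_index w \<or>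
     (jet_index v = jet_index w \<and> jet_order v \<le> jet_order w)"

definition less_jet_var :: "jet_var \<Rightarrow> jet_var \<Rightarrow> bool" where
  "v < w \<longleftrightarrow> jet_index v < jet_index w \<or>
     (jet_index v = jet_index w \<and> jet_order v < jet_order w)"

instance
  by standard (auto simp: less_eq_jet_var_def less_jet_var_def jet_var.expand)

end

abbreviation jet :: "nat \<Rightarrow> nat \<Rightarrow> jet_var cpoly" where
  "jet i l \<equiv> Var (Jet i l)"

definition jet_ring :: "nat \<Rightarrow> nat \<Rightarrow> jet_var cpoly set" where
  "jet_ring n \<kappa> = polys_over {Jet i l |i l. i \<in> {1..n} \<and> l \<in> {1..\<kappa>}}"

text \<open>The total differentiation operator; for each polynomial only finitely many \<open>l\<close> contribute.\<close>

definition total_deriv :: "nat \<Rightarrow> jet_var cpoly \<Rightarrow> jet_var cpoly" where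
  "total_deriv n P = (\<Sum>k=1..n. Sum_any (\<lambda>l. jet k (l + 1) * partial_deriv (Jet k l) P))"

text \<open>The bracket of \<open>P\<close> and \<open>Q\<close>, taken as having weights \<open>p\<close> and \<open>q\<close>.\<close>

definition bracket :: "nat \<Rightarrow> nat \<Rightarrow> nat \<Rightarrow> jet_var cpoly \<Rightarrow> jet_var cpoly \<Rightarrow> jet_var cpoly" where
  "bracket n p q P Q = of_nat q * total_deriv n P * Q - of_nat p * P * total_deriv n Q"

text \<open>\<open>Lambda n i r\<close> is \<open>\<Lambda>\<close> with lower indices \<open>1,i;1^r\<close>; its weight is \<open>2r + 3\<close>.\<close>

primrec Lambda :: "nat \<Rightarrow> nat \<Rightarrow> nat \<Rightarrow> jet_var cpoly" where
  "Lambda n i 0 = bracket n 1 1 (jet i 1) (jet 1 1)"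
| "Lambda n i (Suc r) = bracket n (2 * r + 3) 1 (Lambda n i r) (jet 1 1)"


section \<open>Invariance by reparametrization\<close>

definition local_biholomorphism :: "(complex \<Rightarrow> complex) \<Rightarrow> bool" where
  "local_biholomorphism \<phi> \<longleftrightarrow> \<phi> 0 = 0 \<and>
     (\<exists>U V \<psi>. open U \<and> open V \<and> 0 \<in> U \<and> \<phi> holomorphic_on U \<and> \<psi> holomorphic_on V \<and>
        \<phi> ` U = V \<and> (\<forall>z\<in>U. \<psi> (\<phi> z) = z))"

definition eval_jet :: "jet_var cpoly \<Rightarrow> (nat \<Rightarrow> complex \<Rightarrow> complex) \<Rightarrow> complex \<Rightarrow> complex" where
  "eval_jet P f t = eval_at (\<lambda>v. (deriv ^^ jet_order v) (f (jet_index v)) t) P"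

text \<open>The identity defining invariance is one of germs at the origin.\<close>

definition invariants :: "nat \<Rightarrow> nat \<Rightarrow> nat \<Rightarrow> jet_var cpoly set" where
  "invariants n \<kappa> m =
     {P \<in> jet_ring n \<kappa>. \<forall>f \<phi>.
        (\<forall>i\<in>{1..n}. f i analytic_on {0}) \<longrightarrow> local_biholomorphism \<phi> \<longrightarrow>
        (\<forall>\<^sub>F t in nhds 0. eval_jet P (\<lambda>i. f i \<circ> \<phi>) t = deriv \<phi> t ^ m * eval_jet P f (\<phi> t))}"


section \<open>The polynomials \<open>P_a\<close>\<close>

text \<open>\<open>A i r\<close> stands for the variable \<open>A_i^(2r+3)\<close>.\<close>

datatype gen_var = F nat | A nat nat

fun gen_weight :: "gen_var \<Rightarrow> nat" where
  "gen_weight (F i) = 1"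
| "gen_weight (A i r) = 2 * r + 3"

fun gen_value :: "nat \<Rightarrow> gen_var \<Rightarrow> jet_var cpoly" where
  "gen_value n (F i) = jet i 1"
| "gen_value n (A i r) = Lambda n i r"

definition gen_ring :: "nat \<Rightarrow> nat \<Rightarrow> gen_var cpoly set" where
  "gen_ring n \<kappa> =
     polys_over ({F i |i. i \<in> {2..n}} \<union> {A i r |i r. i \<in> {2..n} \<and> r + 2 \<le> \<kappa>})"

definition weighted_homogeneous :: "nat \<Rightarrow> gen_var cpoly \<Rightarrow> bool" where
  "weighted_homogeneous d Q \<longleftrightarrow>
     (\<forall>\<delta>. subst (\<lambda>v. Const (\<delta> ^ gen_weight v) * Var v) Q = Const (\<delta> ^ d) * Q)"

definition exponents :: "nat \<Rightarrow> nat \<Rightarrow> int set" where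
  "exponents \<kappa> m = {a. - ((real \<kappa> - 1) / real \<kappa>) * real m \<le> real_of_int a \<and> a \<le> int m}"

definition admissible :: "nat \<Rightarrow> nat \<Rightarrow> nat \<Rightarrow> (int \<Rightarrow> gen_var cpoly) \<Rightarrow> bool" where
  "admissible n \<kappa> m Pa \<longleftrightarrow>
     (\<forall>a\<in>exponents \<kappa> m. Pa a \<in> gen_ring n \<kappa> \<and> weighted_homogeneous (nat (int m - a)) (Pa a))"

text \<open>Since \<open>a\<close> may be negative, the sum lives in the fraction field of the jet polynomials.\<close>

definition expansion :: "nat \<Rightarrow> nat \<Rightarrow> nat \<Rightarrow> (int \<Rightarrow> gen_var cpoly) \<Rightarrow> jet_var cpoly fract" where
  "expansion n \<kappa> m Pa =
     (\<Sum>a\<in>exponents \<kappa> m. to_fract (jet 1 1) powi a * to_fract (subst (gen_value n) (Pa a)))"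

end

(* Where f_1' does not vanish, f can be reparametrized by the local inverse of f_1. The normalized
   germ has first component the identity, and on such germs Lambda_{1,i;1^r} is just the derivative
   f_i^(r+2); since the Lambda are invariant, the jet of the normalized germ consists of the
   quotients f_i'/f_1' and Lambda_{1,i;1^(l-2)} / (f_1')^(2l-1). Evaluating P there gives the
   expansion, and isobaricity of P bounds the exponents of f_1'. *)

theory Submission
  imports Defs
begin

section \<open>Substitution homomorphisms\<close>

text \<open>\<open>invariants\<close> is an analytic condition on germs, while the expansion is an
  identity of rational functions. Two facts connect them: every point of jet space is the jet of an
  entire map (\<open>exists_jet\<close>), and a polynomial identity may be tested where f_1' is
  nonzero (\<open>poly_eqI_generic\<close>). Denominators are cleared with (f_1')^m, which suffices
  because every admissible a is at least -m.

  The constant (\<kappa> - 1)/\<kappa> compares two weights. For i \<ge> 2 the coordinate f_i^(l)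
  counts l in the isobaric weight m of P, but its substitute has denominator (f_1')^(2l - 1). As 2l
  - 1 \<le> (2 - 1/\<kappa>) l for l \<le> \<kappa>, the denominators remove at most (2 -
  1/\<kappa>) m factors from the (f_1')^m that invariance contributes, which leaves a \<ge>
  -((\<kappa> - 1)/\<kappa>) m.

  The converse clears denominators and must then cancel a power of f_1'. The obstacle is a germ with
  f_1'(0) = 0, where the cleared identity says nothing; continuity in a perturbation of f_1 deals
  with it.\<close>

abbreviation mono_val :: "('v \<Rightarrow> 'b) \<Rightarrow> ('v \<Rightarrow>\<^sub>0 nat) \<Rightarrow> 'b :: comm_semiring_1" where
  "mono_val \<sigma> \<mu> \<equiv> \<Prod>v\<in>Poly_Mapping.keys \<mu>. \<sigma> v ^ Poly_Mapping.lookup \<mu> v"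

lemma mono_val_superset:
  assumes "finite V" "Poly_Mapping.keys \<mu> \<subseteq> V"
  shows "mono_val \<sigma> \<mu> = (\<Prod>v\<in>V. \<sigma> v ^ Poly_Mapping.lookup \<mu> v)"
  by (rule prod.mono_neutral_left) (use assms in \<open>auto simp: in_keys_iff\<close>)

lemma keys_add_nat:
  "Poly_Mapping.keys (\<mu> + \<nu>) = Poly_Mapping.keys \<mu> \<union> Poly_Mapping.keys (\<nu> :: 'v \<Rightarrow>\<^sub>0 nat)"
  by (auto simp: in_keys_iff lookup_add)

lemma mono_val_add: "mono_val \<sigma> (\<mu> + \<nu>) = mono_val \<sigma> \<mu> * mono_val \<sigma> \<nu>"
proof -
  let ?V = "Poly_Mapping.keys \<mu> \<union> Poly_Mapping.keys \<nu>"
  show ?thesis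
    by (simp add: keys_add_nat mono_val_superset[of ?V \<mu>] mono_val_superset[of ?V \<nu>]
        lookup_add power_add prod.distrib)
qed

lemma mono_val_mult: "mono_val (\<lambda>v. s v * \<sigma> v) \<mu> = mono_val s \<mu> * mono_val \<sigma> \<mu>"
  by (simp add: power_mult_distrib prod.distrib)

lemma poly_eq_sum_single:
  "P = (\<Sum>\<mu>\<in>Poly_Mapping.keys P. Poly_Mapping.single \<mu> (Poly_Mapping.lookup P \<mu>))"
proof (rule poly_mapping_eqI)
  fix \<nu>
  show "Poly_Mapping.lookup P \<nu> =
    Poly_Mapping.lookup (\<Sum>\<mu>\<in>Poly_Mapping.keys P. Poly_Mapping.single \<mu> (Poly_Mapping.lookup P \<mu>)) \<nu>"
    by (simp add: lookup_sum lookup_single when_def sum.delta in_keys_iff)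
qed

lemma Const_0 [simp]: "Const 0 = 0"
  and Const_1 [simp]: "Const 1 = 1"
  and Const_add: "Const (a + b) = Const a + Const b"
  and Const_mult: "Const (a * b) = Const a * Const b"
  by (simp_all add: Const_def single_add mult_single)

lemma Const_power: "Const (a ^ k) = Const a ^ k"
  by (induction k) (simp_all add: Const_mult)

text \<open>Evaluation and substitution are both \<open>subst_with c\<close> for a semiring
  homomorphism \<open>c\<close>; the locale proves the homomorphism laws once for the two of
  them.\<close>

locale coeff_hom =
  fixes c :: "complex \<Rightarrow> 'b :: comm_semiring_1"
  assumes c_0: "c 0 = 0" and c_1: "c 1 = 1"
    and c_add: "c (a + b) = c a + c b" and c_mult: "c (a * b) = c a * c b"
begin

lemma subst_with_superset:
  assumes "finite K" "Poly_Mapping.keys P \<subseteq> K"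
  shows "subst_with c \<sigma> P = (\<Sum>\<mu>\<in>K. c (Poly_Mapping.lookup P \<mu>) * mono_val \<sigma> \<mu>)"
  unfolding subst_with_def
  by (rule sum.mono_neutral_left) (use assms in \<open>auto simp: in_keys_iff c_0\<close>)

lemma subst_with_0: "subst_with c \<sigma> 0 = 0"
  by (simp add: subst_with_def)

lemma subst_with_add: "subst_with c \<sigma> (P + Q) = subst_with c \<sigma> P + subst_with c \<sigma> Q"
proof -
  let ?K = "Poly_Mapping.keys P \<union> Poly_Mapping.keys Q"
  show ?thesis
    using Poly_Mapping.keys_add[of P Q]
    by (simp add: subst_with_superset[of ?K P] subst_with_superset[of ?K Q]
        subst_with_superset[of ?K "P + Q"] lookup_add c_add distrib_right sum.distrib)
qed

lemma subst_with_sum: "subst_with c \<sigma> (\<Sum>x\<in>S. p x) = (\<Sum>x\<in>S. subst_with c \<sigma> (p x))"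
  by (induction S rule: infinite_finite_induct) (simp_all add: subst_with_0 subst_with_add)

lemma subst_with_single: "subst_with c \<sigma> (Poly_Mapping.single \<mu> a) = c a * mono_val \<sigma> \<mu>"
  by (subst subst_with_superset[of "{\<mu>}"]) auto

lemma subst_with_Const: "subst_with c \<sigma> (Const a) = c a"
  by (simp add: Const_def subst_with_single)

lemma subst_with_Var: "subst_with c \<sigma> (Var v) = \<sigma> v"
  by (simp add: Var_def subst_with_single c_1)

lemma subst_with_1: "subst_with c \<sigma> 1 = 1"
  using subst_with_Const[of \<sigma> 1] by (simp add: c_1)

lemma subst_with_mult: "subst_with c \<sigma> (P * Q) = subst_with c \<sigma> P * subst_with c \<sigma> Q"
proof -
  have "P * Q = (\<Sum>\<mu>\<in>Poly_Mapping.keys P. \<Sum>\<nu>\<in>Poly_Mapping.keys Q.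
      Poly_Mapping.single (\<mu> + \<nu>) (Poly_Mapping.lookup P \<mu> * Poly_Mapping.lookup Q \<nu>))"
    by (subst poly_eq_sum_single[of P], subst poly_eq_sum_single[of Q])
      (simp add: sum_product mult_single)
  then have "subst_with c \<sigma> (P * Q) =
      (\<Sum>\<mu>\<in>Poly_Mapping.keys P. \<Sum>\<nu>\<in>Poly_Mapping.keys Q.
        c (Poly_Mapping.lookup P \<mu>) * mono_val \<sigma> \<mu> * (c (Poly_Mapping.lookup Q \<nu>) * mono_val \<sigma> \<nu>))"
    by (simp only: subst_with_sum subst_with_single mono_val_add c_mult ac_simps)
  then show ?thesis
    by (simp only: subst_with_def sum_product)
qed

lemma subst_with_power: "subst_with c \<sigma> (P ^ k) = subst_with c \<sigma> P ^ k"
  by (induction k) (simp_all add: subst_with_1 subst_with_mult)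

lemma subst_with_prod: "subst_with c \<sigma> (\<Prod>x\<in>S. p x) = (\<Prod>x\<in>S. subst_with c \<sigma> (p x))"
  by (induction S rule: infinite_finite_induct) (simp_all add: subst_with_1 subst_with_mult)

lemma subst_with_subst:
  "subst_with c \<rho> (subst \<sigma> P) = subst_with c (\<lambda>v. subst_with c \<rho> (\<sigma> v)) P"
  unfolding subst_def subst_with_def[of Const] subst_with_def[of c "\<lambda>v. subst_with c \<rho> (\<sigma> v)"]
  by (simp add: subst_with_sum subst_with_mult subst_with_prod subst_with_power subst_with_Const)

lemma subst_with_cong:
  assumes "P \<in> polys_over V" "\<And>v. v \<in> V \<Longrightarrow> \<sigma> v = \<tau> v"
  shows "subst_with c \<sigma> P = subst_with c \<tau> P"
  unfolding subst_with_def
proof (intro sum.cong refl arg_cong2[of _ _ _ _ "(*)"] prod.cong)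
  fix \<mu> v assume "\<mu> \<in> Poly_Mapping.keys P" "v \<in> Poly_Mapping.keys \<mu>"
  then have "v \<in> V"
    using assms(1) by (auto simp: polys_over_def)
  then show "\<sigma> v ^ Poly_Mapping.lookup \<mu> v = \<tau> v ^ Poly_Mapping.lookup \<mu> v"
    by (simp add: assms(2))
qed

end

interpretation eval_hom: coeff_hom "\<lambda>c. c"
  rewrites "subst_with (\<lambda>c. c) = eval_at"
  by unfold_locales (simp_all add: eval_at_def)

interpretation Const_hom: coeff_hom Const
  rewrites "subst_with Const = subst"
  by unfold_locales (simp_all add: subst_def Const_add Const_mult)

lemma eval_at_diff: "eval_at x (P - Q) = eval_at x P - eval_at x Q"
  using eval_hom.subst_with_add[of x "P - Q" Q] by simp

lemma eval_at_of_nat: "eval_at x (of_nat k) = of_nat k"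
  by (induction k) (simp_all add: eval_hom.subst_with_0 eval_hom.subst_with_1 eval_hom.subst_with_add)

lemmas eval_at_simps = eval_hom.subst_with_0 eval_hom.subst_with_1 eval_hom.subst_with_add
  eval_hom.subst_with_mult eval_hom.subst_with_power eval_hom.subst_with_sum
  eval_hom.subst_with_Const eval_hom.subst_with_Var eval_at_diff eval_at_of_nat

subsection \<open>Polynomials over a set of variables\<close>

lemma polys_over_0 [simp]: "0 \<in> polys_over V"
  by (simp add: polys_over_def)

lemma polys_over_single: "Poly_Mapping.keys \<mu> \<subseteq> V \<Longrightarrow> Poly_Mapping.single \<mu> a \<in> polys_over V"
  by (cases "a = 0") (simp_all add: polys_over_def)

lemma polys_over_Const [simp]: "Const a \<in> polys_over V"
  unfolding Const_def by (rule polys_over_single) simp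

lemma polys_over_Var: "v \<in> V \<Longrightarrow> Var v \<in> polys_over V"
  unfolding Var_def by (rule polys_over_single) simp

lemma polys_over_1 [simp]: "1 \<in> polys_over V"
  using polys_over_Const[of 1 V] by simp

lemma polys_over_add: "P \<in> polys_over V \<Longrightarrow> Q \<in> polys_over V \<Longrightarrow> P + Q \<in> polys_over V"
  using Poly_Mapping.keys_add[of P Q] unfolding polys_over_def by blast

lemma polys_over_diff: "P \<in> polys_over V \<Longrightarrow> Q \<in> polys_over V \<Longrightarrow> P - Q \<in> polys_over V"
  using Poly_Mapping.keys_diff[of P Q] unfolding polys_over_def by blast

lemma polys_over_mult:
  assumes "P \<in> polys_over V" "Q \<in> polys_over V"
  shows "P * Q \<in> polys_over V"
  unfolding polys_over_def
proof (intro CollectI ballI)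
  fix \<mu> assume "\<mu> \<in> Poly_Mapping.keys (P * Q)"
  then obtain \<alpha> \<beta> where "\<mu> = \<alpha> + \<beta>" "\<alpha> \<in> Poly_Mapping.keys P" "\<beta> \<in> Poly_Mapping.keys Q"
    using Poly_Mapping.keys_mult[of P Q] by blast
  then show "Poly_Mapping.keys \<mu> \<subseteq> V"
    using assms by (simp add: polys_over_def keys_add_nat)
qed

lemma polys_over_power: "P \<in> polys_over V \<Longrightarrow> P ^ k \<in> polys_over V"
  by (induction k) (simp_all add: polys_over_mult)

lemma polys_over_of_nat [simp]: "of_nat k \<in> polys_over V"
  by (induction k) (simp_all add: polys_over_add)

lemma polys_over_sum: "(\<And>x. x \<in> S \<Longrightarrow> p x \<in> polys_over V) \<Longrightarrow> (\<Sum>x\<in>S. p x) \<in> polys_over V"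
  by (induction S rule: infinite_finite_induct) (simp_all add: polys_over_add)

lemma polys_over_prod: "(\<And>x. x \<in> S \<Longrightarrow> p x \<in> polys_over V) \<Longrightarrow> (\<Prod>x\<in>S. p x) \<in> polys_over V"
  by (induction S rule: infinite_finite_induct) (simp_all add: polys_over_mult)

lemma polys_over_mono: "P \<in> polys_over V \<Longrightarrow> V \<subseteq> W \<Longrightarrow> P \<in> polys_over W"
  by (auto simp: polys_over_def)

lemma polys_over_subst:
  assumes "P \<in> polys_over V" "\<And>v. v \<in> V \<Longrightarrow> \<sigma> v \<in> polys_over W"
  shows "subst \<sigma> P \<in> polys_over W"
  unfolding subst_def subst_with_def
  by (intro polys_over_sum polys_over_mult polys_over_prod polys_over_power polys_over_Const assms(2))
    (use assms(1) in \<open>auto simp: polys_over_def\<close>)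

lemma polys_over_partial_deriv:
  assumes "P \<in> polys_over V"
  shows "partial_deriv v P \<in> polys_over V"
  unfolding partial_deriv_def
proof (rule polys_over_sum)
  fix \<mu> assume "\<mu> \<in> Poly_Mapping.keys P"
  then have "Poly_Mapping.keys \<mu> \<subseteq> V"
    using assms by (auto simp: polys_over_def)
  moreover have "Poly_Mapping.keys (\<mu> - Poly_Mapping.single v 1) \<subseteq> Poly_Mapping.keys \<mu>"
    by (auto simp: in_keys_iff lookup_minus)
  ultimately show "Poly_Mapping.single (\<mu> - Poly_Mapping.single v 1)
      (of_nat (Poly_Mapping.lookup \<mu> v) * Poly_Mapping.lookup P \<mu>) \<in> polys_over V"
    by (auto simp: polys_over_def)
qed

lemma partial_deriv_eq_0:
  assumes "P \<in> polys_over V" "v \<notin> V"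
  shows "partial_deriv v P = 0"
  unfolding partial_deriv_def
proof (rule sum.neutral, rule ballI)
  fix \<mu> assume "\<mu> \<in> Poly_Mapping.keys P"
  then have "v \<notin> Poly_Mapping.keys \<mu>"
    using assms by (auto simp: polys_over_def)
  then show "Poly_Mapping.single (\<mu> - Poly_Mapping.single v 1)
      (of_nat (Poly_Mapping.lookup \<mu> v) * Poly_Mapping.lookup P \<mu>) = 0"
    by (simp add: in_keys_iff)
qed

subsection \<open>Polynomials are determined by their values\<close>

lemma univariate_coeffs_eq_0:
  fixes b :: "nat \<Rightarrow> complex"
  assumes "finite N" "\<And>z. (\<Sum>k\<in>N. b k * z ^ k) = 0" "k \<in> N"
  shows "b k = 0"
proof -
  \<comment> \<open>Gaps in \<open>N\<close> are filled with zero coefficients, so that the result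
    for sums over an initial segment of exponents applies.\<close>
  have "(\<Sum>j\<le>Max N. (if j \<in> N then b j else 0) * z ^ j) = 0" for z
  proof -
    have "(\<Sum>j\<le>Max N. (if j \<in> N then b j else 0) * z ^ j) = (\<Sum>j\<in>N. b j * z ^ j)"
      by (rule sum.mono_neutral_cong_right) (use assms(1) in \<open>auto simp: Max_ge\<close>)
    then show ?thesis using assms(2) by simp
  qed
  then have "(\<lambda>j. if j \<in> N then b j else 0) k = 0"
    using polyfun_eq_0[of "\<lambda>j. if j \<in> N then b j else 0" "Max N"] Max_ge[OF assms(1,3)]
    by simp
  then show ?thesis using assms(3) by simp
qed

text \<open>Induction on the variables: varying \<open>v\<close> alone gives a univariate polynomial
  whose coefficients are the parts of the sum with a fixed exponent of \<open>v\<close>, and each of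
  these vanishes. The third hypothesis asks only that exponents in \<open>K\<close> be told apart on
  \<open>V\<close>; this passes to a part, where the exponents of \<open>v\<close> agree.\<close>

lemma monomials_linearly_independent:
  fixes c :: "('v \<Rightarrow> nat) \<Rightarrow> complex"
  assumes "finite V" "finite K"
    and "\<And>\<mu> \<nu>. \<mu> \<in> K \<Longrightarrow> \<nu> \<in> K \<Longrightarrow> (\<And>v. v \<in> V \<Longrightarrow> \<mu> v = \<nu> v) \<Longrightarrow> \<mu> = \<nu>"
    and "\<And>x. (\<Sum>\<mu>\<in>K. c \<mu> * (\<Prod>v\<in>V. x v ^ \<mu> v)) = 0"
    and "\<mu> \<in> K"
  shows "c \<mu> = 0"
  using assms
proof (induction V arbitrary: K \<mu> rule: finite_induct)
  case empty
  then have "K = {\<mu>}" by auto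
  with empty.prems(3) show ?case by simp
next
  case (insert v V)
  let ?K = "\<lambda>k. {\<nu>\<in>K. \<nu> v = k}"
  have slice: "(\<Sum>\<nu>\<in>?K k. c \<nu> * (\<Prod>w\<in>V. x w ^ \<nu> w)) = 0" if "k \<in> (\<lambda>\<nu>. \<nu> v) ` K" for k x
  proof (rule univariate_coeffs_eq_0[OF _ _ that])
    show "finite ((\<lambda>\<nu>. \<nu> v) ` K)"
      using insert.prems(1) by simp
    fix z
    have eq: "(\<Prod>w\<in>insert v V. (x(v := z)) w ^ \<nu> w) = z ^ \<nu> v * (\<Prod>w\<in>V. x w ^ \<nu> w)" for \<nu>
    proof -
      have "(\<Prod>w\<in>V. (x(v := z)) w ^ \<nu> w) = (\<Prod>w\<in>V. x w ^ \<nu> w)"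
        by (rule prod.cong) (use insert.hyps in auto)
      then show ?thesis using insert.hyps by simp
    qed
    have "(\<Sum>k\<in>(\<lambda>\<nu>. \<nu> v) ` K. (\<Sum>\<nu>\<in>?K k. c \<nu> * (\<Prod>w\<in>V. x w ^ \<nu> w)) * z ^ k)
        = (\<Sum>k\<in>(\<lambda>\<nu>. \<nu> v) ` K. \<Sum>\<nu>\<in>?K k. c \<nu> * (\<Prod>w\<in>insert v V. (x(v := z)) w ^ \<nu> w))"
      unfolding eq sum_distrib_right by (intro sum.cong refl) auto
    also have "\<dots> = (\<Sum>\<nu>\<in>K. c \<nu> * (\<Prod>w\<in>insert v V. (x(v := z)) w ^ \<nu> w))"
      using sum.image_gen[OF insert.prems(1), symmetric] .
    also have "\<dots> = 0"
      by (rule insert.prems(3))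
    finally show "(\<Sum>k\<in>(\<lambda>\<nu>. \<nu> v) ` K. (\<Sum>\<nu>\<in>?K k. c \<nu> * (\<Prod>w\<in>V. x w ^ \<nu> w)) * z ^ k) = 0" .
  qed
  show ?case
  proof (rule insert.IH[of "?K (\<mu> v)"])
    show "finite (?K (\<mu> v))" "\<mu> \<in> ?K (\<mu> v)"
      using insert.prems by auto
    show "\<alpha> = \<beta>" if "\<alpha> \<in> ?K (\<mu> v)" "\<beta> \<in> ?K (\<mu> v)" "\<And>w. w \<in> V \<Longrightarrow> \<alpha> w = \<beta> w" for \<alpha> \<beta>
      by (rule insert.prems(2)) (use that in auto)
    show "(\<Sum>\<nu>\<in>?K (\<mu> v). c \<nu> * (\<Prod>w\<in>V. x w ^ \<nu> w)) = 0" for x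
      using slice[of "\<mu> v" x] insert.prems(4) by auto
  qed
qed

lemma coeffs_eq_0_if_eval_eq_0:
  fixes c :: "('v \<Rightarrow>\<^sub>0 nat) \<Rightarrow> complex"
  assumes "finite K" "\<And>x. (\<Sum>\<mu>\<in>K. c \<mu> * mono_val x \<mu>) = 0" "\<mu> \<in> K"
  shows "c \<mu> = 0"
proof -
  let ?V = "\<Union>\<mu>\<in>K. Poly_Mapping.keys \<mu>"
  \<comment> \<open>The independence lemma speaks of plain exponent functions; composing
    \<open>c\<close> with the inverse of \<open>lookup\<close> transports the coefficients to
    them.\<close>
  have "(c \<circ> Poly_Mapping.Abs_poly_mapping) (Poly_Mapping.lookup \<mu>) = 0"
  proof (rule monomials_linearly_independent[of ?V "Poly_Mapping.lookup ` K"])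
    show "finite ?V" "finite (Poly_Mapping.lookup ` K)" "Poly_Mapping.lookup \<mu> \<in> Poly_Mapping.lookup ` K"
      using assms by auto
    show "\<alpha> = \<beta>" if \<alpha>: "\<alpha> \<in> Poly_Mapping.lookup ` K" and \<beta>: "\<beta> \<in> Poly_Mapping.lookup ` K"
      and eq: "\<And>v. v \<in> ?V \<Longrightarrow> \<alpha> v = \<beta> v" for \<alpha> \<beta>
    proof
      fix v
      show "\<alpha> v = \<beta> v"
      proof (cases "v \<in> ?V")
        case False
        then have "\<gamma> v = 0" if "\<gamma> \<in> Poly_Mapping.lookup ` K" for \<gamma>
          using that by (auto simp: in_keys_iff)
        from this[OF \<alpha>] this[OF \<beta>] show ?thesis by simp
      qed (rule eq)
    qed
    fix x :: "'v \<Rightarrow> complex"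
    have "mono_val x \<nu> = (\<Prod>v\<in>?V. x v ^ Poly_Mapping.lookup \<nu> v)" if "\<nu> \<in> K" for \<nu>
      by (rule mono_val_superset) (use assms(1) that in auto)
    then have "(\<Sum>\<mu>\<in>K. c \<mu> * (\<Prod>v\<in>?V. x v ^ Poly_Mapping.lookup \<mu> v)) = 0"
      using assms(2)[of x] by (metis (no_types, lifting) sum.cong)
    moreover have "inj_on Poly_Mapping.lookup K"
      by (simp add: inj_on_def Poly_Mapping.lookup_inject)
    ultimately show "(\<Sum>\<nu>\<in>Poly_Mapping.lookup ` K. (c \<circ> Poly_Mapping.Abs_poly_mapping) \<nu> * (\<Prod>v\<in>?V. x v ^ \<nu> v)) = 0"
      by (simp add: sum.reindex Poly_Mapping.lookup_inverse)
  qed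
  then show ?thesis by (simp add: Poly_Mapping.lookup_inverse)
qed

lemma poly_eq_0_if_eval_eq_0:
  assumes "\<And>x. eval_at x P = 0"
  shows "P = 0"
proof (rule poly_mapping_eqI)
  fix \<mu>
  have "Poly_Mapping.lookup P \<mu> = 0" if "\<mu> \<in> Poly_Mapping.keys P"
    by (rule coeffs_eq_0_if_eval_eq_0[OF _ _ that])
      (use assms in \<open>simp_all add: eval_at_def subst_with_def\<close>)
  then show "Poly_Mapping.lookup P \<mu> = Poly_Mapping.lookup 0 \<mu>"
    by (auto simp: in_keys_iff)
qed

lemma Var_neq_0: "Var v \<noteq> (0 :: 'v cpoly)"
proof
  assume "Var v = (0 :: 'v cpoly)"
  then have "eval_at (\<lambda>_. 1) (Var v) = eval_at (\<lambda>_. 1) (0 :: 'v cpoly)"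
    by (rule arg_cong)
  then show False
    by (simp only: eval_hom.subst_with_Var eval_hom.subst_with_0 one_neq_zero)
qed

text \<open>Multiplying the difference by \<open>Var v\<close> makes it vanish on the excluded
  hyperplane as well; the factor is then cancelled in the integral domain.\<close>

lemma poly_eqI_generic:
  fixes P Q :: "'v :: linorder cpoly"
  assumes "\<And>x. x v \<noteq> 0 \<Longrightarrow> eval_at x P = eval_at x Q"
  shows "P = Q"
proof -
  have "eval_at x (Var v * (P - Q)) = 0" for x
    using assms[of x] by (cases "x v = 0") (simp_all add: eval_at_simps)
  then have "Var v * (P - Q) = 0"
    by (rule poly_eq_0_if_eval_eq_0)
  then have "P - Q = 0"
    by (metis mult_eq_0_iff Var_neq_0)
  then show ?thesis
    by (simp only: right_minus_eq)
qed

section \<open>Differentiation along curves\<close>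

text \<open>The chain rule, tying the formal \<open>partial_deriv\<close> to differentiation; the
  product rule on each monomial and an exchange of sums give it.\<close>

lemma has_field_derivative_eval_at:
  assumes V: "finite V" "P \<in> polys_over V"
    and x: "\<And>v. v \<in> V \<Longrightarrow> (x v has_field_derivative x' v) (at t)"
  shows "((\<lambda>s. eval_at (\<lambda>v. x v s) P) has_field_derivative
    (\<Sum>v\<in>V. x' v * eval_at (\<lambda>v. x v t) (partial_deriv v P))) (at t)"
proof -
  have keys: "Poly_Mapping.keys \<mu> \<subseteq> V" if "\<mu> \<in> Poly_Mapping.keys P" for \<mu>
    using V(2) that by (auto simp: polys_over_def)
  let ?y = "\<lambda>v. x v t"
  let ?m = "\<lambda>\<mu> v. of_nat (Poly_Mapping.lookup \<mu> v) * ?y v ^ (Poly_Mapping.lookup \<mu> v - 1) *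
    (\<Prod>w\<in>V - {v}. ?y w ^ Poly_Mapping.lookup \<mu> w)"
  have "((\<lambda>s. \<Sum>\<mu>\<in>Poly_Mapping.keys P. Poly_Mapping.lookup P \<mu> * (\<Prod>v\<in>V. x v s ^ Poly_Mapping.lookup \<mu> v))
      has_field_derivative (\<Sum>\<mu>\<in>Poly_Mapping.keys P. Poly_Mapping.lookup P \<mu> * (\<Sum>v\<in>V. x' v * ?m \<mu> v))) (at t)"
  proof (intro DERIV_sum DERIV_cmult)
    fix \<mu>
    have "((\<lambda>s. \<Prod>v\<in>V. x v s ^ Poly_Mapping.lookup \<mu> v) has_field_derivative
        (\<Sum>v\<in>V. (of_nat (Poly_Mapping.lookup \<mu> v) * (x' v * ?y v ^ (Poly_Mapping.lookup \<mu> v - Suc 0))) *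
          (\<Prod>w\<in>V - {v}. ?y w ^ Poly_Mapping.lookup \<mu> w))) (at t)"
      by (intro has_field_derivative_prod DERIV_power x)
    then show "((\<lambda>s. \<Prod>v\<in>V. x v s ^ Poly_Mapping.lookup \<mu> v) has_field_derivative (\<Sum>v\<in>V. x' v * ?m \<mu> v)) (at t)"
      by (simp add: mult_ac)
  qed
  moreover have "eval_at (\<lambda>v. x v s) P =
      (\<Sum>\<mu>\<in>Poly_Mapping.keys P. Poly_Mapping.lookup P \<mu> * (\<Prod>v\<in>V. x v s ^ Poly_Mapping.lookup \<mu> v))" for s
    unfolding eval_at_def subst_with_def
    by (intro sum.cong refl arg_cong2[of _ _ _ _ "(*)"] mono_val_superset V(1) keys)
  moreover have "eval_at ?y (partial_deriv v P) = (\<Sum>\<mu>\<in>Poly_Mapping.keys P. Poly_Mapping.lookup P \<mu> * ?m \<mu> v)"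
    if v: "v \<in> V" for v
  proof -
    \<comment> \<open>Subtraction is truncated on both sides, so this holds for exponent 0 too; such
      a term is then killed by its factor \<open>lookup \<mu> v\<close>.\<close>
    have mono: "mono_val ?y (\<mu> - Poly_Mapping.single v 1) =
        ?y v ^ (Poly_Mapping.lookup \<mu> v - 1) * (\<Prod>w\<in>V - {v}. ?y w ^ Poly_Mapping.lookup \<mu> w)"
      if "\<mu> \<in> Poly_Mapping.keys P" for \<mu>
    proof -
      have "Poly_Mapping.keys (\<mu> - Poly_Mapping.single v 1) \<subseteq> V"
        using keys[OF that] by (auto simp: in_keys_iff lookup_minus)
      then have "mono_val ?y (\<mu> - Poly_Mapping.single v 1) =
          (\<Prod>w\<in>V. ?y w ^ Poly_Mapping.lookup (\<mu> - Poly_Mapping.single v 1) w)"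
        by (rule mono_val_superset[OF V(1)])
      also have "\<dots> = ?y v ^ (Poly_Mapping.lookup \<mu> v - 1) *
          (\<Prod>w\<in>V - {v}. ?y w ^ Poly_Mapping.lookup (\<mu> - Poly_Mapping.single v 1) w)"
        by (subst prod.remove[OF V(1) v]) (simp add: lookup_minus)
      also have "(\<Prod>w\<in>V - {v}. ?y w ^ Poly_Mapping.lookup (\<mu> - Poly_Mapping.single v 1) w)
          = (\<Prod>w\<in>V - {v}. ?y w ^ Poly_Mapping.lookup \<mu> w)"
        by (intro prod.cong refl) (auto simp: lookup_minus lookup_single when_def)
      finally show ?thesis .
    qed
    show ?thesis
      unfolding partial_deriv_def eval_hom.subst_with_sum eval_hom.subst_with_single
    proof (intro sum.cong refl)
      fix \<mu> assume \<mu>: "\<mu> \<in> Poly_Mapping.keys P"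
      show "of_nat (Poly_Mapping.lookup \<mu> v) * Poly_Mapping.lookup P \<mu> * mono_val ?y (\<mu> - Poly_Mapping.single v 1)
          = Poly_Mapping.lookup P \<mu> * ?m \<mu> v"
        unfolding mono[OF \<mu>] by (simp only: mult_ac)
    qed
  qed
  moreover have "(\<Sum>\<mu>\<in>Poly_Mapping.keys P. Poly_Mapping.lookup P \<mu> * (\<Sum>v\<in>V. x' v * ?m \<mu> v))
      = (\<Sum>v\<in>V. x' v * (\<Sum>\<mu>\<in>Poly_Mapping.keys P. Poly_Mapping.lookup P \<mu> * ?m \<mu> v))"
    unfolding sum_distrib_left by (subst sum.swap) (simp only: mult_ac)
  ultimately show ?thesis
    by simp
qed

lemma isCont_eval_at:
  assumes "\<And>v. isCont (\<lambda>s. x s v) t"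
  shows "isCont (\<lambda>s. eval_at (x s) P) t"
  unfolding eval_at_def subst_with_def by (intro continuous_intros assms)

definition jet_vars :: "nat \<Rightarrow> nat \<Rightarrow> jet_var set" where
  "jet_vars n \<kappa> = {Jet i l |i l. i \<in> {1..n} \<and> l \<in> {1..\<kappa>}}"

lemma jet_ring_eq: "jet_ring n \<kappa> = polys_over (jet_vars n \<kappa>)"
  by (simp add: jet_ring_def jet_vars_def)

lemma jet_vars_image: "jet_vars n \<kappa> = (\<lambda>(i, l). Jet i l) ` ({1..n} \<times> {1..\<kappa>})"
  by (auto simp: jet_vars_def)

lemma Jet_in_jet_vars [simp]: "Jet i l \<in> jet_vars n \<kappa> \<longleftrightarrow> i \<in> {1..n} \<and> l \<in> {1..\<kappa>}"
  by (auto simp: jet_vars_def)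

lemma finite_jet_vars [simp]: "finite (jet_vars n \<kappa>)"
  by (simp add: jet_vars_image)

lemma sum_jet_vars: "(\<Sum>v\<in>jet_vars n \<kappa>. h v) = (\<Sum>i=1..n. \<Sum>l=1..\<kappa>. h (Jet i l))"
proof -
  have "inj_on (\<lambda>(i, l). Jet i l) ({1..n} \<times> {1..\<kappa>})"
    by (auto intro: inj_onI)
  then show ?thesis
    by (simp add: jet_vars_image sum.reindex sum.cartesian_product case_prod_unfold o_def)
qed

lemma jet_vars_mono: "\<kappa> \<le> \<kappa>' \<Longrightarrow> jet_vars n \<kappa> \<subseteq> jet_vars n \<kappa>'"
  by (auto simp: jet_vars_def)

lemma jet_in_jet_ring: "i \<in> {1..n} \<Longrightarrow> l \<in> {1..\<kappa>} \<Longrightarrow> jet i l \<in> jet_ring n \<kappa>"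
  by (simp add: jet_ring_eq polys_over_Var)

lemma total_deriv_eq:
  assumes "P \<in> jet_ring n \<kappa>"
  shows "total_deriv n P = (\<Sum>i=1..n. \<Sum>l=1..\<kappa>. jet i (l + 1) * partial_deriv (Jet i l) P)"
  unfolding total_deriv_def
proof (rule sum.cong[OF refl])
  fix i
  have "partial_deriv (Jet i l) P = 0" if "l \<notin> {1..\<kappa>}" for l
    by (rule partial_deriv_eq_0[of _ "jet_vars n \<kappa>"]) (use assms that in \<open>auto simp: jet_ring_eq\<close>)
  then have "{l. jet i (l + 1) * partial_deriv (Jet i l) P \<noteq> 0} \<subseteq> {1..\<kappa>}"
    by (metis (mono_tags, lifting) mem_Collect_eq mult_zero_right subsetI)
  then show "Sum_any (\<lambda>l. jet i (l + 1) * partial_deriv (Jet i l) P)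
      = (\<Sum>l=1..\<kappa>. jet i (l + 1) * partial_deriv (Jet i l) P)"
    by (rule Sum_any.expand_superset[OF finite_atLeastAtMost])
qed

lemma total_deriv_in_jet_ring:
  assumes "P \<in> jet_ring n \<kappa>"
  shows "total_deriv n P \<in> jet_ring n (Suc \<kappa>)"
proof -
  have "P \<in> polys_over (jet_vars n (Suc \<kappa>))"
    using assms jet_vars_mono[of \<kappa> "Suc \<kappa>" n] polys_over_mono by (auto simp: jet_ring_eq)
  then show ?thesis
    unfolding total_deriv_eq[OF assms] jet_ring_eq
    by (intro polys_over_sum polys_over_mult polys_over_partial_deriv polys_over_Var) auto
qed

lemma eval_jet_bracket:
  "eval_jet (bracket n p q P Q) f t =
     of_nat q * eval_jet (total_deriv n P) f t * eval_jet Q f t -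
     of_nat p * eval_jet P f t * eval_jet (total_deriv n Q) f t"
  by (simp add: eval_jet_def bracket_def eval_at_simps)

lemma eval_jet_jet: "eval_jet (jet i l) f t = (deriv ^^ l) (f i) t"
  by (simp add: eval_jet_def eval_at_simps)

text \<open>The bridge between germs and points: only finitely many coordinates enter
  \<open>P\<close>, so a germ may replace any point of jet space with which it agrees up to order
  \<kappa>.\<close>

lemma eval_jet_cong:
  assumes "P \<in> jet_ring n \<kappa>"
    and "\<And>i l. i \<in> {1..n} \<Longrightarrow> l \<in> {1..\<kappa>} \<Longrightarrow> (deriv ^^ l) (f i) s = x (Jet i l)"
  shows "eval_jet P f s = eval_at x P"
  unfolding eval_jet_def
  by (rule eval_hom.subst_with_cong[of _ "jet_vars n \<kappa>"]) (use assms in \<open>auto simp: jet_ring_eq jet_vars_def\<close>)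

text \<open>This justifies \<open>total_deriv\<close>: along the jet of a curve the coordinate of
  order l has the coordinate of order l + 1 as derivative.\<close>

lemma has_field_derivative_eval_jet:
  assumes P: "P \<in> jet_ring n \<kappa>" and f: "\<And>i. i \<in> {1..n} \<Longrightarrow> f i analytic_on {t}"
  shows "(eval_jet P f has_field_derivative eval_jet (total_deriv n P) f t) (at t)"
proof -
  have "((\<lambda>s. eval_at (\<lambda>v. (deriv ^^ jet_order v) (f (jet_index v)) s) P) has_field_derivative
     (\<Sum>v\<in>jet_vars n \<kappa>. (deriv ^^ Suc (jet_order v)) (f (jet_index v)) t *
       eval_at (\<lambda>v. (deriv ^^ jet_order v) (f (jet_index v)) t) (partial_deriv v P))) (at t)"
  proof (rule has_field_derivative_eval_at)
    fix v assume "v \<in> jet_vars n \<kappa>"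
    then have "(deriv ^^ jet_order v) (f (jet_index v)) analytic_on {t}"
      using f by (auto simp: jet_vars_def intro!: analytic_higher_deriv)
    then have "(deriv ^^ jet_order v) (f (jet_index v)) field_differentiable at t"
      by (simp add: analytic_on_imp_differentiable_at)
    then show "((deriv ^^ jet_order v) (f (jet_index v)) has_field_derivative
        (deriv ^^ Suc (jet_order v)) (f (jet_index v)) t) (at t)"
      using field_differentiable_derivI by simp
  qed (use P in \<open>simp_all add: jet_ring_eq\<close>)
  moreover have "eval_jet (total_deriv n P) f t =
     (\<Sum>v\<in>jet_vars n \<kappa>. (deriv ^^ Suc (jet_order v)) (f (jet_index v)) t *
       eval_at (\<lambda>v. (deriv ^^ jet_order v) (f (jet_index v)) t) (partial_deriv v P))"
    unfolding total_deriv_eq[OF P] sum_jet_vars by (simp add: eval_jet_def eval_at_simps)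
  moreover have "eval_jet P f = (\<lambda>s. eval_at (\<lambda>v. (deriv ^^ jet_order v) (f (jet_index v)) s) P)"
    by (simp add: fun_eq_iff eval_jet_def)
  ultimately show ?thesis
    by simp
qed

section \<open>Invariants\<close>

lemma eventually_analytic_at:
  assumes "f analytic_on {t}"
  shows "\<forall>\<^sub>F s in nhds t. f analytic_on {s}"
proof -
  obtain S where "open S" "t \<in> S" "f holomorphic_on S"
    using assms by (auto simp: analytic_at)
  then show ?thesis
    unfolding eventually_nhds by (intro exI[of _ S]) (auto simp: analytic_at)
qed

lemma local_biholomorphism_analytic: "local_biholomorphism \<phi> \<Longrightarrow> \<phi> analytic_on {0}"
  by (auto simp: local_biholomorphism_def analytic_at)

lemma local_biholomorphism_0: "local_biholomorphism \<phi> \<Longrightarrow> \<phi> 0 = 0"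
  by (simp add: local_biholomorphism_def)

lemma local_biholomorphism_deriv_nonzero:
  assumes "local_biholomorphism \<phi>"
  shows "deriv \<phi> 0 \<noteq> 0"
proof -
  obtain U \<psi> where "open U" "0 \<in> U" "\<phi> holomorphic_on U" "\<forall>z\<in>U. \<psi> (\<phi> z) = z"
    using assms by (auto simp: local_biholomorphism_def)
  then show ?thesis
    using holomorphic_injective_imp_regular[of \<phi> U 0] by (metis inj_on_inverseI)
qed

lemma eventually_local_biholomorphism:
  assumes "local_biholomorphism \<phi>" "eventually p (nhds 0)"
  shows "\<forall>\<^sub>F t in nhds 0. p (\<phi> t)"
proof -
  have "isCont \<phi> 0"
    by (rule analytic_at_imp_isCont) (rule local_biholomorphism_analytic[OF assms(1)])
  then have "filterlim \<phi> (nhds 0) (nhds 0)"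
    using tendsto_at_iff_tendsto_nhds[of \<phi> 0]
    by (simp add: isCont_def local_biholomorphism_0[OF assms(1)])
  then show ?thesis
    using assms(2) by (simp add: filterlim_iff)
qed

lemma analytic_comp_local_biholomorphism:
  assumes "local_biholomorphism \<phi>" "f analytic_on {0}"
  shows "f \<circ> \<phi> analytic_on {0}"
  using assms by (intro analytic_on_compose local_biholomorphism_analytic)
    (simp_all add: local_biholomorphism_0)

lemma invariants_in_jet_ring: "P \<in> invariants n \<kappa> m \<Longrightarrow> P \<in> jet_ring n \<kappa>"
  by (simp add: invariants_def)

lemma invariants_mono: "\<kappa> \<le> \<kappa>' \<Longrightarrow> P \<in> invariants n \<kappa> m \<Longrightarrow> P \<in> invariants n \<kappa>' m"
  using polys_over_mono[OF _ jet_vars_mono] by (auto simp: invariants_def jet_ring_eq)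

lemma invariants_at_0:
  assumes "P \<in> invariants n \<kappa> m" "\<And>i. i \<in> {1..n} \<Longrightarrow> f i analytic_on {0}" "local_biholomorphism \<phi>"
  shows "eval_jet P (\<lambda>i. f i \<circ> \<phi>) 0 = deriv \<phi> 0 ^ m * eval_jet P f 0"
proof -
  have "\<forall>\<^sub>F t in nhds 0. eval_jet P (\<lambda>i. f i \<circ> \<phi>) t = deriv \<phi> t ^ m * eval_jet P f (\<phi> t)"
    using assms by (simp add: invariants_def)
  from eventually_nhds_x_imp_x[OF this] show ?thesis
    by (simp add: local_biholomorphism_0[OF assms(3)])
qed

text \<open>By translation in source and target, it suffices to compare the two sides at the origin.\<close>

lemma invariantsI:
  assumes P: "P \<in> jet_ring n \<kappa>"
    and inv: "\<And>f \<phi>. (\<And>i. i \<in> {1..n} \<Longrightarrow> f i analytic_on {0}) \<Longrightarrow> local_biholomorphism \<phi> \<Longrightarrow>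
      eval_jet P (\<lambda>i. f i \<circ> \<phi>) 0 = deriv \<phi> 0 ^ m * eval_jet P f 0"
  shows "P \<in> invariants n \<kappa> m"
  unfolding invariants_def
proof (intro CollectI conjI allI impI P)
  fix f :: "nat \<Rightarrow> complex \<Rightarrow> complex" and \<phi>
  assume f: "\<forall>i\<in>{1..n}. f i analytic_on {0}" and \<phi>: "local_biholomorphism \<phi>"
  obtain U V \<psi> where U: "open U" "open V" "0 \<in> U" "\<phi> holomorphic_on U" "\<psi> holomorphic_on V"
      "\<phi> ` U = V" "\<forall>z\<in>U. \<psi> (\<phi> z) = z"
    using \<phi> by (auto simp: local_biholomorphism_def)
  have "\<forall>\<^sub>F t in nhds 0. t \<in> U"
    using U by (simp add: eventually_nhds_in_open)
  moreover have "\<forall>\<^sub>F t in nhds 0. \<forall>i\<in>{1..n}. f i analytic_on {\<phi> t}"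
    using f by (intro eventually_local_biholomorphism[OF \<phi>] eventually_ball_finite)
      (auto intro: eventually_analytic_at)
  ultimately show "\<forall>\<^sub>F t in nhds 0. eval_jet P (\<lambda>i. f i \<circ> \<phi>) t = deriv \<phi> t ^ m * eval_jet P f (\<phi> t)"
  proof eventually_elim
    case (elim t)
    \<comment> \<open>The translations are chosen so that \<theta> fixes 0 and
      \<open>g i \<circ> \<theta>\<close> is \<open>f i \<circ> \<phi>\<close> shifted by
      \<open>t\<close>: the two middle translations by \<open>\<phi> t\<close> cancel.\<close>
    define g where "g i z = f i (\<phi> t + z)" for i z
    define \<theta> where "\<theta> z = \<phi> (t + z) - \<phi> t" for z
    have shift: "eval_jet P (\<lambda>i z. h i (s + z)) 0 = eval_jet P h s" for h s
      unfolding eval_jet_def higher_deriv_shift_0[of _ _ s] by (simp add: o_def)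
    have g: "g i analytic_on {0}" if "i \<in> {1..n}" for i
    proof -
      have "f i \<circ> (\<lambda>z. \<phi> t + z) analytic_on {0}"
        by (intro analytic_on_compose analytic_intros) (use elim that in auto)
      then show ?thesis by (simp add: g_def[abs_def] o_def)
    qed
    have \<theta>: "local_biholomorphism \<theta>"
      unfolding local_biholomorphism_def
    proof (intro conjI exI)
      show "\<theta> 0 = 0" by (simp add: \<theta>_def)
      show "open ((\<lambda>z. z + - t) ` U)" "open ((\<lambda>z. z + - \<phi> t) ` V)"
        using U by (intro open_translation_subtract[unfolded diff_conv_add_uminus]; simp)+
      show "0 \<in> (\<lambda>z. z + - t) ` U"
        using elim by force
      show "\<theta> holomorphic_on (\<lambda>z. z + - t) ` U"
        unfolding \<theta>_def[abs_def]
        by (intro holomorphic_intros holomorphic_on_compose_gen[OF _ U(4), of "\<lambda>z. t + z", unfolded o_def]) auto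
      show "(\<lambda>w. \<psi> (\<phi> t + w) - t) holomorphic_on (\<lambda>z. z + - \<phi> t) ` V"
        by (intro holomorphic_intros holomorphic_on_compose_gen[OF _ U(5), of "\<lambda>w. \<phi> t + w", unfolded o_def]) auto
      show "\<theta> ` (\<lambda>z. z + - t) ` U = (\<lambda>z. z + - \<phi> t) ` V"
        by (auto simp: \<theta>_def image_image U(6)[symmetric])
      show "\<forall>z\<in>(\<lambda>z. z + - t) ` U. \<psi> (\<phi> t + \<theta> z) - t = z"
        using U(7) by (auto simp: \<theta>_def)
    qed
    have "eval_jet P (\<lambda>i. g i \<circ> \<theta>) 0 = deriv \<theta> 0 ^ m * eval_jet P g 0"
      by (rule inv[OF g \<theta>])
    moreover have "eval_jet P g 0 = eval_jet P f (\<phi> t)"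
      using shift[of f "\<phi> t"] by (simp add: g_def[abs_def])
    moreover have "eval_jet P (\<lambda>i. g i \<circ> \<theta>) 0 = eval_jet P (\<lambda>i. f i \<circ> \<phi>) t"
      using shift[of "\<lambda>i. f i \<circ> \<phi>" t] by (simp add: g_def[abs_def] \<theta>_def[abs_def] o_def)
    moreover have "deriv \<theta> 0 = deriv \<phi> t"
    proof -
      have "(\<phi> has_field_derivative deriv \<phi> t) (at (t + 0))"
        using holomorphic_derivI[OF U(4,1)] elim by simp
      then have "((\<lambda>z. \<phi> (t + z)) has_field_derivative deriv \<phi> t) (at 0)"
        using DERIV_shift[of \<phi> _ 0 t] by (simp add: add.commute)
      then have "(\<theta> has_field_derivative deriv \<phi> t - 0) (at 0)"
        unfolding \<theta>_def[abs_def] by (intro DERIV_diff DERIV_const)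
      then show ?thesis
        by (simp add: DERIV_imp_deriv)
    qed
    ultimately show ?case by simp
  qed
qed

section \<open>Operations that preserve invariance\<close>

lemma jet_in_invariants:
  assumes "i \<in> {1..n}"
  shows "jet i 1 \<in> invariants n (Suc 0) 1"
proof (rule invariantsI)
  show "jet i 1 \<in> jet_ring n (Suc 0)"
    using assms by (intro jet_in_jet_ring) auto
  fix f :: "nat \<Rightarrow> complex \<Rightarrow> complex" and \<phi>
  assume f: "\<And>i. i \<in> {1..n} \<Longrightarrow> f i analytic_on {0}" and \<phi>: "local_biholomorphism \<phi>"
  have "\<phi> field_differentiable at 0" "f i field_differentiable at (\<phi> 0)"
    using f[OF assms] local_biholomorphism_analytic[OF \<phi>]
    by (auto simp: local_biholomorphism_0[OF \<phi>] intro: analytic_on_imp_differentiable_at)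
  then show "eval_jet (jet i 1) (\<lambda>i. f i \<circ> \<phi>) 0 = deriv \<phi> 0 ^ 1 * eval_jet (jet i 1) f 0"
    by (simp add: eval_jet_jet deriv_chain local_biholomorphism_0[OF \<phi>])
qed

text \<open>Differentiating the transformation law of P gives the expected term (\<phi>')^(p+1) D P
  and an extra term in \<phi>''. The coefficients q and p of the bracket are those for which the
  extra terms of P and Q cancel.\<close>

lemma bracket_in_invariants:
  assumes P: "P \<in> invariants n \<kappa> p" and Q: "Q \<in> invariants n \<kappa> q"
  shows "bracket n p q P Q \<in> invariants n (Suc \<kappa>) (p + q + 1)"
  unfolding invariants_def
proof (intro CollectI conjI allI impI)
  have PQ: "P \<in> jet_ring n \<kappa>" "Q \<in> jet_ring n \<kappa>"
    using P Q by (auto dest: invariants_in_jet_ring)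
  then have "P \<in> jet_ring n (Suc \<kappa>)" "Q \<in> jet_ring n (Suc \<kappa>)"
    using polys_over_mono[OF _ jet_vars_mono[of \<kappa> "Suc \<kappa>" n]] by (auto simp: jet_ring_eq)
  then show "bracket n p q P Q \<in> jet_ring n (Suc \<kappa>)"
    using total_deriv_in_jet_ring[OF PQ(1)] total_deriv_in_jet_ring[OF PQ(2)]
    unfolding bracket_def jet_ring_eq by (intro polys_over_diff polys_over_mult polys_over_of_nat)
  fix f :: "nat \<Rightarrow> complex \<Rightarrow> complex" and \<phi>
  assume f: "\<forall>i\<in>{1..n}. f i analytic_on {0}" and \<phi>: "local_biholomorphism \<phi>"
  have "\<forall>\<^sub>F t in nhds 0. \<forall>i\<in>{1..n}. f i analytic_on {\<phi> t}"
    using f by (intro eventually_local_biholomorphism[OF \<phi>] eventually_ball_finite)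
      (auto intro: eventually_analytic_at)
  moreover have "\<forall>\<^sub>F t in nhds 0. \<forall>i\<in>{1..n}. f i \<circ> \<phi> analytic_on {t}"
    using f by (intro eventually_ball_finite)
      (auto intro!: eventually_analytic_at analytic_comp_local_biholomorphism[OF \<phi>])
  moreover have "\<forall>\<^sub>F t in nhds 0. \<phi> analytic_on {t}"
    by (intro eventually_analytic_at local_biholomorphism_analytic[OF \<phi>])
  \<comment> \<open>The law must hold in a neighbourhood of each \<open>t\<close>, not just at
    \<open>t\<close>, because it is about to be differentiated there.\<close>
  moreover have "\<forall>\<^sub>F t in nhds 0. \<forall>\<^sub>F s in nhds t.
      eval_jet P (\<lambda>i. f i \<circ> \<phi>) s = deriv \<phi> s ^ p * eval_jet P f (\<phi> s)"
    using P f \<phi> by (simp add: invariants_def eventually_eventually)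
  moreover have "\<forall>\<^sub>F t in nhds 0. \<forall>\<^sub>F s in nhds t.
      eval_jet Q (\<lambda>i. f i \<circ> \<phi>) s = deriv \<phi> s ^ q * eval_jet Q f (\<phi> s)"
    using Q f \<phi> by (simp add: invariants_def eventually_eventually)
  ultimately show "\<forall>\<^sub>F t in nhds 0. eval_jet (bracket n p q P Q) (\<lambda>i. f i \<circ> \<phi>) t =
      deriv \<phi> t ^ (p + q + 1) * eval_jet (bracket n p q P Q) f (\<phi> t)"
  proof eventually_elim
    case (elim t)
    let ?d = "deriv \<phi> t"
    have \<phi>': "(\<phi> has_field_derivative ?d) (at t)"
      using elim(3) by (simp add: analytic_on_imp_differentiable_at field_differentiable_derivI)
    have \<phi>'': "(deriv \<phi> has_field_derivative deriv (deriv \<phi>) t) (at t)"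
      using analytic_higher_deriv[OF elim(3), of 1]
      by (simp add: analytic_on_imp_differentiable_at field_differentiable_derivI)
    \<comment> \<open>The transformation law of weight \<open>w\<close> differentiated at
      \<open>t\<close>: the left side directly, the right side by the product and chain
      rules.\<close>
    have D: "eval_jet (total_deriv n T) (\<lambda>i. f i \<circ> \<phi>) t =
        of_nat w * (deriv (deriv \<phi>) t * ?d ^ (w - Suc 0)) * eval_jet T f (\<phi> t) +
        eval_jet (total_deriv n T) f (\<phi> t) * ?d * ?d ^ w"
      if T: "T \<in> jet_ring n \<kappa>" and
        ev: "\<forall>\<^sub>F s in nhds t. eval_jet T (\<lambda>i. f i \<circ> \<phi>) s = deriv \<phi> s ^ w * eval_jet T f (\<phi> s)" for T w
    proof -
      have "(eval_jet T (\<lambda>i. f i \<circ> \<phi>) has_field_derivative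
          eval_jet (total_deriv n T) (\<lambda>i. f i \<circ> \<phi>) t) (at t)"
        by (rule has_field_derivative_eval_jet[OF T]) (use elim(2) in auto)
      then have "((\<lambda>s. deriv \<phi> s ^ w * eval_jet T f (\<phi> s)) has_field_derivative
          eval_jet (total_deriv n T) (\<lambda>i. f i \<circ> \<phi>) t) (at t)"
        using DERIV_cong_ev[OF refl ev refl] by simp
      moreover have "(eval_jet T f has_field_derivative eval_jet (total_deriv n T) f (\<phi> t)) (at (\<phi> t))"
        by (rule has_field_derivative_eval_jet[OF T]) (use elim(1) in auto)
      then have "((\<lambda>s. deriv \<phi> s ^ w * eval_jet T f (\<phi> s)) has_field_derivative
          of_nat w * (deriv (deriv \<phi>) t * ?d ^ (w - Suc 0)) * eval_jet T f (\<phi> t) +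
          eval_jet (total_deriv n T) f (\<phi> t) * ?d * ?d ^ w) (at t)"
        by (intro DERIV_mult DERIV_power \<phi>'' DERIV_chain2[OF _ \<phi>'])
      ultimately show ?thesis
        by (rule DERIV_unique)
    qed
    have vals: "eval_jet P (\<lambda>i. f i \<circ> \<phi>) t = ?d ^ p * eval_jet P f (\<phi> t)"
        "eval_jet Q (\<lambda>i. f i \<circ> \<phi>) t = ?d ^ q * eval_jet Q f (\<phi> t)"
      using elim(4,5) by (auto dest: eventually_nhds_x_imp_x)
    show ?case
      unfolding eval_jet_bracket D[OF PQ(1) elim(4)] D[OF PQ(2) elim(5)] vals
      \<comment> \<open>Both \<phi>'' terms are p q \<phi>'' (\<phi>')^(p+q-1) P Q. The case split
        resolves the truncated exponents; at weight 0 the term has coefficient 0.\<close>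
      by (cases p; cases q) (simp_all add: algebra_simps power_add)
  qed
qed

text \<open>Each bracket with f_1', of weight 1, raises the jet order by 1 and the weight by 1 +
  1.\<close>

lemma Lambda_in_invariants:
  assumes "i \<in> {1..n}" "1 \<le> n"
  shows "Lambda n i r \<in> invariants n (r + 2) (2 * r + 3)"
proof (induction r)
  case 0
  have "bracket n 1 1 (jet i 1) (jet 1 1) \<in> invariants n (Suc (Suc 0)) (1 + 1 + 1)"
    using assms by (intro bracket_in_invariants jet_in_invariants) auto
  then show ?case by (simp add: numeral_eq_Suc)
next
  case (Suc r)
  have "jet 1 1 \<in> invariants n (r + 2) 1"
    using assms by (intro invariants_mono[OF _ jet_in_invariants]) auto
  from bracket_in_invariants[OF Suc this]
  show ?case by (simp add: numeral_eq_Suc)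
qed

lemma mult_in_invariants:
  assumes P: "P \<in> invariants n \<kappa> p" and Q: "Q \<in> invariants n \<kappa> q"
  shows "P * Q \<in> invariants n \<kappa> (p + q)"
proof (rule invariantsI)
  show "P * Q \<in> jet_ring n \<kappa>"
    using assms[THEN invariants_in_jet_ring] by (simp add: jet_ring_eq polys_over_mult)
  fix f :: "nat \<Rightarrow> complex \<Rightarrow> complex" and \<phi>
  assume f: "\<And>i. i \<in> {1..n} \<Longrightarrow> f i analytic_on {0}" and \<phi>: "local_biholomorphism \<phi>"
  show "eval_jet (P * Q) (\<lambda>i. f i \<circ> \<phi>) 0 = deriv \<phi> 0 ^ (p + q) * eval_jet (P * Q) f 0"
    using invariants_at_0[where f = f, OF P f \<phi>] invariants_at_0[where f = f, OF Q f \<phi>]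
    by (simp add: eval_jet_def eval_at_simps power_add)
qed

lemma sum_in_invariants:
  assumes P: "\<And>a. a \<in> S \<Longrightarrow> p a \<in> invariants n \<kappa> m"
  shows "(\<Sum>a\<in>S. p a) \<in> invariants n \<kappa> m"
proof (rule invariantsI)
  show "(\<Sum>a\<in>S. p a) \<in> jet_ring n \<kappa>"
    using P[THEN invariants_in_jet_ring] by (simp add: jet_ring_eq polys_over_sum)
  fix f :: "nat \<Rightarrow> complex \<Rightarrow> complex" and \<phi>
  assume f: "\<And>i. i \<in> {1..n} \<Longrightarrow> f i analytic_on {0}" and \<phi>: "local_biholomorphism \<phi>"
  show "eval_jet (\<Sum>a\<in>S. p a) (\<lambda>i. f i \<circ> \<phi>) 0 = deriv \<phi> 0 ^ m * eval_jet (\<Sum>a\<in>S. p a) f 0"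
    using invariants_at_0[where f = f, OF P f \<phi>]
    by (simp add: eval_jet_def eval_at_simps sum_distrib_left)
qed

lemma one_in_invariants: "1 \<in> invariants n \<kappa> 0"
  by (rule invariantsI) (simp_all add: jet_ring_eq eval_jet_def eval_at_simps)

lemma power_in_invariants: "P \<in> invariants n \<kappa> p \<Longrightarrow> P ^ k \<in> invariants n \<kappa> (k * p)"
  by (induction k) (simp_all add: one_in_invariants mult_in_invariants)

text \<open>Reparametrization multiplies the generator for \<open>v\<close> by \<phi>'(0)^(w v), so
  homogeneity of \<open>Q\<close> at \<delta> = \<phi>'(0) extracts the single factor
  \<phi>'(0)^d.\<close>

lemma subst_in_invariants:
  assumes Q: "Q \<in> polys_over V" and g: "\<And>v. v \<in> V \<Longrightarrow> g v \<in> invariants n \<kappa> (w v)"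
    and hom: "\<And>\<delta>. subst (\<lambda>v. Const (\<delta> ^ w v) * Var v) Q = Const (\<delta> ^ d) * Q"
  shows "subst g Q \<in> invariants n \<kappa> d"
proof (rule invariantsI)
  show "subst g Q \<in> jet_ring n \<kappa>"
    unfolding jet_ring_eq by (rule polys_over_subst[OF Q]) (use g[THEN invariants_in_jet_ring] in \<open>simp add: jet_ring_eq\<close>)
  fix f :: "nat \<Rightarrow> complex \<Rightarrow> complex" and \<phi>
  assume f: "\<And>i. i \<in> {1..n} \<Longrightarrow> f i analytic_on {0}" and \<phi>: "local_biholomorphism \<phi>"
  have subst: "eval_jet (subst g Q) h 0 = eval_at (\<lambda>v. eval_jet (g v) h 0) Q" for h
    by (simp add: eval_jet_def eval_hom.subst_with_subst)
  have "eval_jet (subst g Q) (\<lambda>i. f i \<circ> \<phi>) 0 = eval_at (\<lambda>v. deriv \<phi> 0 ^ w v * eval_jet (g v) f 0) Q"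
    unfolding subst by (rule eval_hom.subst_with_cong[OF Q]) (rule invariants_at_0[OF g f \<phi>])
  also have "\<dots> = eval_at (\<lambda>v. eval_jet (g v) f 0) (subst (\<lambda>v. Const (deriv \<phi> 0 ^ w v) * Var v) Q)"
    by (simp add: eval_hom.subst_with_subst eval_at_simps)
  also have "\<dots> = deriv \<phi> 0 ^ d * eval_jet (subst g Q) f 0"
    unfolding hom subst by (simp add: eval_at_simps)
  finally show "eval_jet (subst g Q) (\<lambda>i. f i \<circ> \<phi>) 0 = deriv \<phi> 0 ^ d * eval_jet (subst g Q) f 0" .
qed

text \<open>The factor can be cancelled directly where \<open>f_1'\<close> does not vanish; perturbing \<open>f_1\<close> by
  \<open>\<epsilon> z\<close> and letting \<open>\<epsilon>\<close> tend to \<open>0\<close> covers the remaining germs.\<close>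

lemma invariants_cancel_power:
  assumes n: "1 \<le> n" and \<kappa>: "1 \<le> \<kappa>" and R: "R \<in> jet_ring n \<kappa>"
    and inv: "jet 1 1 ^ N * R \<in> invariants n \<kappa> (m + N)"
  shows "R \<in> invariants n \<kappa> m"
proof (rule invariantsI[OF R])
  fix f :: "nat \<Rightarrow> complex \<Rightarrow> complex" and \<phi>
  assume f: "\<And>i. i \<in> {1..n} \<Longrightarrow> f i analytic_on {0}" and \<phi>: "local_biholomorphism \<phi>"
  define g where "g \<epsilon> i = (if i = 1 then \<lambda>z. f 1 z + \<epsilon> * z else f i)" for \<epsilon> :: complex and i
  \<comment> \<open>The jet of \<open>h\<close> after adding \<epsilon> \<psi> to its first
    component, affine in \<epsilon>. It serves \<psi> = id for \<open>g \<epsilon>\<close>, and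
    \<psi> = \<phi> after composition, since (f_1 + \<epsilon> z) composed with \<phi> is f_1
    composed with \<phi>, plus \<epsilon> \<phi>.\<close>
  define x where "x h \<psi> \<epsilon> v = (deriv ^^ jet_order v) (h (jet_index v)) 0 +
    \<epsilon> * (if jet_index v = 1 then (deriv ^^ jet_order v) \<psi> 0 else 0)"
    for h :: "nat \<Rightarrow> complex \<Rightarrow> complex" and \<psi> \<epsilon> v
  have g: "g \<epsilon> i analytic_on {0}" if "i \<in> {1..n}" for \<epsilon> i
    using f[OF that] by (auto simp: g_def intro!: analytic_intros)
  have pert: "(deriv ^^ l) (\<lambda>z. h z + \<epsilon> * \<psi> z) 0 = (deriv ^^ l) h 0 + \<epsilon> * (deriv ^^ l) \<psi> 0"
    if "h analytic_on {0}" "\<psi> analytic_on {0}" for h \<psi> :: "complex \<Rightarrow> complex" and \<epsilon> l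
  proof -
    have "(deriv ^^ l) (\<lambda>z. \<epsilon> * \<psi> z) 0 = \<epsilon> * (deriv ^^ l) \<psi> 0"
      using that(2) by (simp add: higher_deriv_cmult')
    moreover have "(\<lambda>z. \<epsilon> * \<psi> z) analytic_on {0}"
      using that(2) by (intro analytic_intros)
    ultimately show ?thesis
      using higher_deriv_add_at[OF that(1)] by simp
  qed
  have eval_g: "eval_jet R (g \<epsilon>) 0 = eval_at (x f (\<lambda>z. z) \<epsilon>) R" for \<epsilon>
    by (rule eval_jet_cong[OF R]) (use f pert[of _ "\<lambda>z. z"] in \<open>auto simp: g_def x_def\<close>)
  have eval_g\<phi>: "eval_jet R (\<lambda>i. g \<epsilon> i \<circ> \<phi>) 0 = eval_at (x (\<lambda>i. f i \<circ> \<phi>) \<phi> \<epsilon>) R" for \<epsilon>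
  proof (rule eval_jet_cong[OF R])
    fix i l assume i: "i \<in> {1..n}"
    have "f i \<circ> \<phi> analytic_on {0}"
      by (intro analytic_comp_local_biholomorphism[OF \<phi>] f i)
    from pert[OF this local_biholomorphism_analytic[OF \<phi>], of l \<epsilon>]
    show "(deriv ^^ l) (g \<epsilon> i \<circ> \<phi>) 0 = x (\<lambda>i. f i \<circ> \<phi>) \<phi> \<epsilon> (Jet i l)"
      by (cases "i = 1") (simp_all add: g_def x_def o_def)
  qed
  define H where "H \<epsilon> = eval_jet R (\<lambda>i. g \<epsilon> i \<circ> \<phi>) 0 - deriv \<phi> 0 ^ m * eval_jet R (g \<epsilon>) 0" for \<epsilon>
  \<comment> \<open>The excluded \<epsilon> is the only one for which the perturbed first component
    has zero derivative at 0. \<open>H\<close> measures the failure of invariance.\<close>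
  have generic: "H \<epsilon> = 0" if \<epsilon>: "\<epsilon> \<noteq> - deriv (f 1) 0" for \<epsilon>
  proof -
    have "deriv (g \<epsilon> 1) 0 = deriv (f 1) 0 + \<epsilon>"
      using pert[of "f 1" "\<lambda>z. z" 1 \<epsilon>] f[of 1] n by (simp add: g_def)
    then have nz: "deriv (g \<epsilon> 1) 0 \<noteq> 0"
      using \<epsilon> by (simp add: add_eq_0_iff)
    have "deriv (g \<epsilon> 1 \<circ> \<phi>) 0 = deriv \<phi> 0 * deriv (g \<epsilon> 1) 0"
      using invariants_at_0[where f = "g \<epsilon>", OF jet_in_invariants[of 1 n] g \<phi>] n by (simp add: eval_jet_jet)
    moreover have "eval_jet (jet 1 1 ^ N * R) (\<lambda>i. g \<epsilon> i \<circ> \<phi>) 0 =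
        deriv \<phi> 0 ^ (m + N) * eval_jet (jet 1 1 ^ N * R) (g \<epsilon>) 0"
      by (rule invariants_at_0[where f = "g \<epsilon>", OF inv g \<phi>])
    moreover have "eval_jet (jet 1 1 ^ N * R) h 0 = deriv (h 1) 0 ^ N * eval_jet R h 0" for h
      by (simp add: eval_jet_def eval_at_simps)
    \<comment> \<open>By the invariance of f_1', its power absorbs (\<phi>')^N out of
      (\<phi>')^(m+N), leaving (\<phi>')^m for R.\<close>
    ultimately have "(deriv \<phi> 0 * deriv (g \<epsilon> 1) 0) ^ N * eval_jet R (\<lambda>i. g \<epsilon> i \<circ> \<phi>) 0 =
        (deriv \<phi> 0 * deriv (g \<epsilon> 1) 0) ^ N * (deriv \<phi> 0 ^ m * eval_jet R (g \<epsilon>) 0)"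
      by (simp add: power_add power_mult_distrib mult_ac)
    then show ?thesis
      using nz local_biholomorphism_deriv_nonzero[OF \<phi>] by (simp add: H_def)
  qed
  have "isCont H 0"
    unfolding H_def[abs_def] eval_g eval_g\<phi> x_def by (intro continuous_intros isCont_eval_at)
  then have "H \<midarrow>0\<rightarrow> H 0"
    by (simp add: isCont_def)
  moreover have "\<forall>\<^sub>F \<epsilon> in at 0. \<epsilon> \<noteq> - deriv (f 1) 0"
    by (rule eventually_neq_at_within)
  then have "\<forall>\<^sub>F \<epsilon> in at 0. H \<epsilon> = 0"
    by eventually_elim (rule generic)
  then have "H \<midarrow>0\<rightarrow> 0"
    by (rule tendsto_eventually)
  ultimately have "H 0 = 0"
    by (rule LIM_unique)
  moreover have "g 0 = f"
    by (auto simp: g_def fun_eq_iff)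
  ultimately show "eval_jet R (\<lambda>i. f i \<circ> \<phi>) 0 = deriv \<phi> 0 ^ m * eval_jet R f 0"
    by (simp add: H_def)
qed

section \<open>Normalization of the first coordinate\<close>

text \<open>Induction on \<kappa>: adding c z^(\<kappa>+1) leaves the derivatives of order at most
  \<kappa> at 0 unchanged, so \<open>c\<close> can be fitted to the next one alone.\<close>

lemma entire_with_jet:
  obtains f :: "complex \<Rightarrow> complex"
  where "f holomorphic_on UNIV" "f 0 = 0" "\<And>l. l \<in> {1..\<kappa>} \<Longrightarrow> (deriv ^^ l) f 0 = x l"
proof -
  have "\<exists>f. f holomorphic_on UNIV \<and> f 0 = 0 \<and> (\<forall>l\<in>{1..\<kappa>}. (deriv ^^ l) f 0 = x l)"
  proof (induction \<kappa>)
    case 0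
    show ?case by (rule exI[of _ "\<lambda>_. 0"]) simp
  next
    case (Suc \<kappa>)
    then obtain f where f: "f holomorphic_on UNIV" "f 0 = 0" "\<forall>l\<in>{1..\<kappa>}. (deriv ^^ l) f 0 = x l"
      by blast
    \<comment> \<open>The derivative of order \<kappa> + 1 of z^(\<kappa>+1) is the factorial of
      \<kappa> + 1; it appears below as a Pochhammer symbol starting at 1.\<close>
    define c where "c = (x (Suc \<kappa>) - (deriv ^^ Suc \<kappa>) f 0) / fact (Suc \<kappa>)"
    have "(deriv ^^ l) (\<lambda>z. f z + c * z ^ Suc \<kappa>) 0 =
        (deriv ^^ l) f 0 + c * (pochhammer (of_nat (Suc (Suc \<kappa>) - l)) l * 0 ^ (Suc \<kappa> - l))" for l
    proof -
      have "(deriv ^^ l) (\<lambda>z. f z + c * z ^ Suc \<kappa>) 0 =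
          (deriv ^^ l) f 0 + (deriv ^^ l) (\<lambda>z. c * z ^ Suc \<kappa>) 0"
        by (rule higher_deriv_add[OF f(1)]) (auto intro!: holomorphic_intros)
      also have "(deriv ^^ l) (\<lambda>z. c * z ^ Suc \<kappa>) 0 = c * (deriv ^^ l) (\<lambda>z. z ^ Suc \<kappa>) 0"
        by (rule higher_deriv_cmult'[of _ 0]) (auto intro!: analytic_intros)
      also have "(deriv ^^ l) (\<lambda>z. z ^ Suc \<kappa>) 0 =
          (pochhammer (of_nat (Suc (Suc \<kappa>) - l)) l * 0 ^ (Suc \<kappa> - l) :: complex)"
        using higher_deriv_power[of l 0 "Suc \<kappa>" 0] by simp
      finally show ?thesis .
    qed
    note D = this
    have "(deriv ^^ l) (\<lambda>z. f z + c * z ^ Suc \<kappa>) 0 = x l" if "l \<in> {1..Suc \<kappa>}" for l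
    proof (cases "l = Suc \<kappa>")
      case True
      have "pochhammer 1 (Suc \<kappa>) = (fact (Suc \<kappa>) :: complex)"
        by (rule pochhammer_fact[symmetric])
      then show ?thesis
        unfolding D True by (simp add: c_def del: fact_Suc pochhammer_Suc)
    next
      case False
      with that f(3) show ?thesis
        unfolding D by auto
    qed
    then show ?case
      using f(1,2) by (intro exI[of _ "\<lambda>z. f z + c * z ^ Suc \<kappa>"]) (auto intro!: holomorphic_intros)
  qed
  then show ?thesis
    using that by blast
qed

text \<open>This lets an identity known for germs be read at an arbitrary point of jet space. The
  value 0 at the origin makes the local inverse of a component fix the origin.\<close>

lemma exists_jet:
  fixes x :: "jet_var \<Rightarrow> complex"
  obtains f where "\<And>i. f i holomorphic_on UNIV" "\<And>i. f i 0 = 0"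
    "\<And>i l. l \<in> {1..\<kappa>} \<Longrightarrow> (deriv ^^ l) (f i) 0 = x (Jet i l)"
proof -
  have "\<exists>f. f holomorphic_on UNIV \<and> f 0 = 0 \<and> (\<forall>l\<in>{1..\<kappa>}. (deriv ^^ l) f 0 = x (Jet i l))" for i
    by (rule entire_with_jet[of \<kappa> "\<lambda>l. x (Jet i l)"]) blast
  then obtain f where "\<forall>i. f i holomorphic_on UNIV \<and> f i 0 = 0 \<and> (\<forall>l\<in>{1..\<kappa>}. (deriv ^^ l) (f i) 0 = x (Jet i l))"
    by metis
  then show ?thesis
    using that by blast
qed

lemma local_inverse:
  assumes "f holomorphic_on UNIV" "f 0 = 0" "deriv f 0 \<noteq> 0"
  obtains \<phi> where "local_biholomorphism \<phi>" "\<forall>\<^sub>F t in nhds 0. f (\<phi> t) = t"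
proof -
  obtain r where r: "r > 0" "open (f ` ball 0 r)" "inj_on f (ball 0 r)"
    using has_complex_derivative_locally_invertible[of f UNIV 0] assms by auto
  have hol: "f holomorphic_on ball 0 r"
    using assms(1) holomorphic_on_subset by blast
  obtain \<phi> where \<phi>: "\<phi> holomorphic_on f ` ball 0 r" "\<And>z. z \<in> ball 0 r \<Longrightarrow> \<phi> (f z) = z"
    using holomorphic_has_inverse[OF hol open_ball r(3)] by metis
  have 0: "0 \<in> f ` ball 0 r"
    using assms(2) r(1) by (auto intro!: image_eqI[of _ _ 0])
  have "local_biholomorphism \<phi>"
    unfolding local_biholomorphism_def
  proof (intro conjI exI)
    show "\<phi> 0 = 0"
      using \<phi>(2)[of 0] assms(2) r(1) by simp
    show "\<phi> ` f ` ball 0 r = ball 0 r"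
      using \<phi>(2) by (auto simp: image_image)
    show "\<forall>z\<in>f ` ball 0 r. f (\<phi> z) = z"
      using \<phi>(2) by auto
  qed (use r 0 \<phi>(1) hol in auto)
  moreover have "\<forall>\<^sub>F t in nhds 0. f (\<phi> t) = t"
    using r(2) 0 \<phi>(2) unfolding eventually_nhds by (intro exI[of _ "f ` ball 0 r"]) auto
  ultimately show ?thesis
    using that by blast
qed

text \<open>With g_1 the identity near 0, f_1' evaluates to 1 and its total derivative to 0, so the
  bracket with f_1' reduces to differentiation in t, whatever the weight \<open>p\<close>.\<close>

lemma eval_bracket_normalized:
  assumes n: "1 \<le> n" and g: "\<And>i. i \<in> {1..n} \<Longrightarrow> g i analytic_on {0}"
    and g1: "\<forall>\<^sub>F t in nhds 0. g 1 t = t"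
    and P: "P \<in> jet_ring n \<kappa>" and ev: "\<forall>\<^sub>F t in nhds 0. eval_jet P g t = h t"
  shows "\<forall>\<^sub>F t in nhds 0. eval_jet (bracket n p 1 P (jet 1 1)) g t = deriv h t"
proof -
  have "\<forall>\<^sub>F t in nhds 0. \<forall>i\<in>{1..n}. g i analytic_on {t}"
    using g by (intro eventually_ball_finite) (auto intro: eventually_analytic_at)
  \<comment> \<open>The nesting pays for two derivatives: the innermost neighbourhood makes f_1'
    equal to 1 at \<open>s\<close>, and this near \<open>t\<close> makes its derivative vanish at
    \<open>t\<close>.\<close>
  moreover have "\<forall>\<^sub>F t in nhds 0. \<forall>\<^sub>F s in nhds t. \<forall>\<^sub>F r in nhds s. g 1 r = r"
    using g1 by (simp add: eventually_eventually)
  moreover have "\<forall>\<^sub>F t in nhds 0. \<forall>\<^sub>F s in nhds t. eval_jet P g s = h s"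
    using ev by (simp add: eventually_eventually)
  ultimately show ?thesis
  proof eventually_elim
    case (elim t)
    have D: "eval_jet (total_deriv n T) g t = deriv (eval_jet T g) t" if "T \<in> jet_ring n k" for T k
      by (rule DERIV_imp_deriv[OF has_field_derivative_eval_jet[OF that], symmetric]) (use elim(1) in blast)
    have one: "\<forall>\<^sub>F s in nhds t. eval_jet (jet 1 1) g s = 1"
      using elim(2)
    proof eventually_elim
      case (elim s)
      then have "deriv (g 1) s = deriv (\<lambda>z. z) s"
        by (intro deriv_cong_ev) auto
      then show ?case by (simp add: eval_jet_jet)
    qed
    then have "deriv (eval_jet (jet 1 1) g) t = deriv (\<lambda>_. 1) t"
      by (rule deriv_cong_ev) simp
    then have "eval_jet (total_deriv n (jet 1 1)) g t = 0"
      using D[OF jet_in_jet_ring[of 1 n 1 1]] n by simp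
    moreover have "eval_jet (total_deriv n P) g t = deriv h t"
      unfolding D[OF P] by (rule deriv_cong_ev[OF elim(3)]) simp
    moreover have "eval_jet (jet 1 1) g t = 1"
      using eventually_nhds_x_imp_x[OF one] .
    ultimately show ?case
      by (simp add: eval_jet_bracket)
  qed
qed

text \<open>The identity is carried on a neighbourhood of 0 rather than at 0, since the next bracket
  differentiates it.\<close>

lemma eval_Lambda_normalized:
  assumes n: "1 \<le> n" and g: "\<And>i. i \<in> {1..n} \<Longrightarrow> g i analytic_on {0}"
    and g1: "\<forall>\<^sub>F t in nhds 0. g 1 t = t" and i: "i \<in> {1..n}"
  shows "\<forall>\<^sub>F t in nhds 0. eval_jet (Lambda n i r) g t = (deriv ^^ (r + 2)) (g i) t"
proof (induction r)
  case 0
  have "\<forall>\<^sub>F t in nhds 0. eval_jet (bracket n 1 1 (jet i 1) (jet 1 1)) g t = deriv (deriv (g i)) t"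
    by (rule eval_bracket_normalized[where \<kappa> = 1 and g = g, OF n g g1 jet_in_jet_ring])
      (use i in \<open>auto simp: eval_jet_jet\<close>)
  then show ?case by (simp add: numeral_eq_Suc)
next
  case (Suc r)
  have "\<forall>\<^sub>F t in nhds 0. eval_jet (bracket n (2 * r + 3) 1 (Lambda n i r) (jet 1 1)) g t =
      deriv ((deriv ^^ (r + 2)) (g i)) t"
    by (rule eval_bracket_normalized[where g = g, OF n g g1 invariants_in_jet_ring[OF Lambda_in_invariants[OF i n]] Suc])
  then show ?case by simp
qed

text \<open>For \<open>x\<close> the jet of f at 0, this is the jet of f composed with the local
  inverse of f_1. The inverse of \<open>x (Jet 1 1)\<close> is the derivative of that local inverse
  at 0, and 2l - 1 = 2(l - 2) + 3 is the weight of \<open>Lambda n i (l - 2)\<close>.\<close>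

definition normalized_point :: "nat \<Rightarrow> (jet_var \<Rightarrow> complex) \<Rightarrow> jet_var \<Rightarrow> complex" where
  "normalized_point n x v = (case v of Jet i l \<Rightarrow>
     if i = 1 then (if l = 1 then 1 else 0)
     else if l = 1 then inverse (x (Jet 1 1)) * x (Jet i 1)
     else inverse (x (Jet 1 1)) ^ (2 * l - 1) * eval_at x (Lambda n i (l - 2)))"

text \<open>Realize \<open>x\<close> as the jet of a map f and compare P at f with P at f composed
  with the local inverse of f_1; the jet of the latter is
  \<open>normalized_point n x\<close>.\<close>

lemma eval_invariant_normalized:
  assumes n: "1 \<le> n" and \<kappa>: "1 \<le> \<kappa>" and P: "P \<in> invariants n \<kappa> m" and x: "x (Jet 1 1) \<noteq> 0"
  shows "eval_at x P = x (Jet 1 1) ^ m * eval_at (normalized_point n x) P"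
proof -
  obtain f where f: "\<And>i. f i holomorphic_on UNIV" "\<And>i. f i 0 = 0"
    "\<And>i l. l \<in> {1..\<kappa>} \<Longrightarrow> (deriv ^^ l) (f i) 0 = x (Jet i l)"
    using exists_jet[of \<kappa> x] by blast
  have fa: "f i analytic_on {0}" for i
    using f(1) by (auto simp: analytic_at)
  have d1: "deriv (f 1) 0 = x (Jet 1 1)"
    using f(3)[of 1 1] \<kappa> by simp
  obtain \<phi> where \<phi>: "local_biholomorphism \<phi>" and ev: "\<forall>\<^sub>F t in nhds 0. f 1 (\<phi> t) = t"
    using local_inverse[OF f(1,2), of 1] x d1 by auto
  define g where "g i = f i \<circ> \<phi>" for i
  have ga: "g i analytic_on {0}" for i
    unfolding g_def by (intro analytic_comp_local_biholomorphism[OF \<phi>] fa)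
  have g1: "\<forall>\<^sub>F t in nhds 0. g 1 t = t"
    using ev by (simp add: g_def)
  have g1_jet: "(deriv ^^ l) (g 1) 0 = (deriv ^^ l) (\<lambda>t. t) 0" for l
    by (rule higher_deriv_cong_ev[OF g1]) simp
  have f_jet: "eval_jet T f 0 = eval_at x T" if "T \<in> jet_ring n \<kappa>" for T
    by (rule eval_jet_cong[OF that]) (rule f(3))
  \<comment> \<open>Used four ways: on f_1' it yields \<phi>'(0), on f_i' and \<open>Lambda\<close>
    it identifies the normalized jet, and on P it gives the claim.\<close>
  have inv: "eval_jet T g 0 = deriv \<phi> 0 ^ w * eval_at x T" if "T \<in> invariants n k w" "k \<le> \<kappa>" for T w k
    using invariants_at_0[OF that(1) fa \<phi>] f_jet[OF invariants_in_jet_ring[OF invariants_mono[OF that(2,1)]]]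
    by (simp add: g_def[abs_def])
  have "1 = deriv \<phi> 0 * x (Jet 1 1)"
    using inv[OF jet_in_invariants[of 1 n]] n \<kappa> g1_jet[of 1] by (simp add: eval_jet_jet eval_at_simps)
  then have d\<phi>: "deriv \<phi> 0 = inverse (x (Jet 1 1))"
    using x by (simp add: field_simps)
  have "eval_jet P g 0 = eval_at (normalized_point n x) P"
  proof (rule eval_jet_cong[OF invariants_in_jet_ring[OF P]])
    fix i l assume i: "i \<in> {1..n}" and l: "l \<in> {1..\<kappa>}"
    consider "i = 1" | "i \<noteq> 1" "l = 1" | "i \<noteq> 1" "l \<ge> 2"
      using l by fastforce
    then show "(deriv ^^ l) (g i) 0 = normalized_point n x (Jet i l)"
    proof cases
      case 1
      then show ?thesis
        using l g1_jet[of l] by (auto simp: normalized_point_def)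
    next
      case 2
      then show ?thesis
        using inv[OF jet_in_invariants[OF i]] \<kappa> by (simp add: eval_jet_jet eval_at_simps normalized_point_def d\<phi>)
    next
      case 3
      then have "(deriv ^^ l) (g i) 0 = (deriv ^^ (l - 2 + 2)) (g i) 0"
        by (simp only: le_add_diff_inverse2)
      also have "\<dots> = eval_jet (Lambda n i (l - 2)) g 0"
        by (rule eventually_nhds_x_imp_x[OF eval_Lambda_normalized[where g = g, OF n ga g1 i], symmetric])
      also have "\<dots> = deriv \<phi> 0 ^ (2 * (l - 2) + 3) * eval_at x (Lambda n i (l - 2))"
        using 3 l by (intro inv[OF Lambda_in_invariants[OF i n]]) auto
      also have "2 * (l - 2) + 3 = 2 * l - 1"
        using 3 by simp
      finally show ?thesis
        using 3 by (simp add: normalized_point_def d\<phi>)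
    qed
  qed
  then have "eval_at (normalized_point n x) P = inverse (x (Jet 1 1)) ^ m * eval_at x P"
    using inv[OF P] by (simp add: d\<phi>)
  then show ?thesis
    using x by (simp add: power_inverse)
qed

section \<open>Weighted degrees\<close>

definition wdeg :: "('v \<Rightarrow> nat) \<Rightarrow> ('v \<Rightarrow>\<^sub>0 nat) \<Rightarrow> nat" where
  "wdeg w \<mu> = (\<Sum>v\<in>Poly_Mapping.keys \<mu>. w v * Poly_Mapping.lookup \<mu> v)"

lemma mono_val_power: "mono_val (\<lambda>v. s ^ w v) \<mu> = s ^ wdeg w \<mu>"
  by (simp add: wdeg_def power_mult[symmetric] power_sum[symmetric])

text \<open>Applied with \<open>s = Const \<delta>\<close> to prove homogeneity of the P_a, and with
  \<open>s\<close> the inverse of f_1' to collect the denominators of a slice.\<close>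

lemma (in coeff_hom) subst_with_scale:
  assumes "\<And>\<mu>. \<mu> \<in> Poly_Mapping.keys Q \<Longrightarrow> wdeg w \<mu> = d"
  shows "subst_with c (\<lambda>v. s ^ w v * \<sigma> v) Q = s ^ d * subst_with c \<sigma> Q"
  unfolding subst_with_def sum_distrib_left
proof (rule sum.cong[OF refl])
  fix \<mu> assume "\<mu> \<in> Poly_Mapping.keys Q"
  then show "c (Poly_Mapping.lookup Q \<mu>) * mono_val (\<lambda>v. s ^ w v * \<sigma> v) \<mu> =
      s ^ d * (c (Poly_Mapping.lookup Q \<mu>) * mono_val \<sigma> \<mu>)"
    unfolding mono_val_mult mono_val_power by (simp add: assms mult_ac)
qed

text \<open>Reparametrizing by z \<mapsto> 2z multiplies f_i^(l) by 2^l and P by 2^m. This one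
  dilation is enough, because distinct powers of 2 separate the weights.\<close>

lemma invariants_isobaric:
  assumes \<kappa>: "1 \<le> \<kappa>" and P: "P \<in> invariants n \<kappa> m" and \<mu>: "\<mu> \<in> Poly_Mapping.keys P"
  shows "wdeg jet_order \<mu> = m"
proof -
  have scale: "eval_at (\<lambda>v. 2 ^ jet_order v * x v) P = 2 ^ m * eval_at x P" for x :: "jet_var \<Rightarrow> complex"
  proof -
    obtain f where f: "\<And>i. f i holomorphic_on UNIV" "\<And>i. f i 0 = 0"
      "\<And>i l. l \<in> {1..\<kappa>} \<Longrightarrow> (deriv ^^ l) (f i) 0 = x (Jet i l)"
      using exists_jet[of \<kappa> x] by blast
    have "local_biholomorphism (\<lambda>z. 2 * z)"
      unfolding local_biholomorphism_def
    proof (intro conjI exI)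
      show "range (\<lambda>z::complex. 2 * z) = UNIV"
        by (rule surjI[of _ "\<lambda>z. z / 2"]) simp
      show "\<forall>z\<in>UNIV. 2 * z / 2 = (z :: complex)"
        by simp
    qed (auto intro!: holomorphic_intros)
    then have "eval_jet P (\<lambda>i. f i \<circ> (\<lambda>z. 2 * z)) 0 = deriv (\<lambda>z. 2 * z) 0 ^ m * eval_jet P f 0"
      by (intro invariants_at_0[OF P]) (use f(1) in \<open>auto simp: analytic_at\<close>)
    moreover have "eval_jet P (\<lambda>i. f i \<circ> (\<lambda>z. 2 * z)) 0 = eval_at (\<lambda>v. 2 ^ jet_order v * x v) P"
    proof (rule eval_jet_cong[OF invariants_in_jet_ring[OF P]])
      fix i l assume "l \<in> {1..\<kappa>}"
      then show "(deriv ^^ l) (f i \<circ> (\<lambda>z. 2 * z)) 0 = 2 ^ jet_order (Jet i l) * x (Jet i l)"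
        using higher_deriv_compose_linear[OF f(1) open_UNIV open_UNIV, of 0 2 l i] f(3)[of l i]
        by (simp add: o_def)
    qed
    moreover have "eval_jet P f 0 = eval_at x P"
      by (rule eval_jet_cong[OF invariants_in_jet_ring[OF P]]) (rule f(3))
    moreover have "deriv (\<lambda>z::complex. 2 * z) 0 = 2"
      by simp
    ultimately show ?thesis
      by simp
  qed
  \<comment> \<open>The polynomial with these coefficients is P(2^l f_i^(l)) - 2^m P, which vanishes
    at every point.\<close>
  have "Poly_Mapping.lookup P \<mu> * (2 ^ wdeg jet_order \<mu> - 2 ^ m) = 0"
  proof (rule coeffs_eq_0_if_eval_eq_0[OF _ _ \<mu>])
    fix x :: "jet_var \<Rightarrow> complex"
    have "(\<Sum>\<nu>\<in>Poly_Mapping.keys P. Poly_Mapping.lookup P \<nu> * mono_val (\<lambda>v. 2 ^ jet_order v * x v) \<nu>) =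
        2 ^ m * (\<Sum>\<nu>\<in>Poly_Mapping.keys P. Poly_Mapping.lookup P \<nu> * mono_val x \<nu>)"
      using scale[of x] unfolding eval_at_def subst_with_def .
    then show "(\<Sum>\<nu>\<in>Poly_Mapping.keys P.
        Poly_Mapping.lookup P \<nu> * (2 ^ wdeg jet_order \<nu> - 2 ^ m) * mono_val x \<nu>) = 0"
      unfolding mono_val_mult mono_val_power
      by (simp add: right_diff_distrib left_diff_distrib sum_subtractf sum_distrib_left mult_ac)
  qed simp
  then have "(2::complex) ^ wdeg jet_order \<mu> = 2 ^ m"
    using \<mu> by (simp add: in_keys_iff)
  then have "of_nat (2 ^ wdeg jet_order \<mu>) = (of_nat (2 ^ m) :: complex)"
    by simp
  then show ?thesis
    unfolding of_nat_eq_iff by simp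
qed

section \<open>The coefficients of the expansion\<close>

text \<open>\<open>gen_weight_of v\<close> is the weight of the generator that replaces \<open>v\<close> on jets with \<open>f_1 = id\<close>;
  since \<open>f_1'\<close> is replaced by \<open>1\<close> there, it is \<open>0\<close> for \<open>f_1\<close>.\<close>

definition gen_weight_of :: "jet_var \<Rightarrow> nat" where
  "gen_weight_of v = (if jet_index v = 1 then 0 else 2 * jet_order v - 1)"

text \<open>The formal counterpart of \<open>normalized_point\<close>: the jet of a germ with first
  component the identity, written in the variables of the P_a. The omitted powers of f_1' are kept
  track of by \<open>gen_weight_of\<close>.\<close>

definition gen_of :: "jet_var \<Rightarrow> gen_var cpoly" where
  "gen_of v = (case v of Jet i l \<Rightarrow>
     if i = 1 then (if l = 1 then 1 else 0) else if l = 1 then Var (F i) else Var (A i (l - 2)))"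

text \<open>\<open>a\<close> is the total exponent of f_1' that a monomial receives:
  \<open>m\<close> from the invariance of P, minus the denominators of its normalized
  coordinates.\<close>

definition slice :: "nat \<Rightarrow> jet_var cpoly \<Rightarrow> int \<Rightarrow> jet_var cpoly" where
  "slice m P a = (\<Sum>\<mu> | \<mu> \<in> Poly_Mapping.keys P \<and> int m - int (wdeg gen_weight_of \<mu>) = a.
     Poly_Mapping.single \<mu> (Poly_Mapping.lookup P \<mu>))"

lemma keys_slice:
  "\<mu> \<in> Poly_Mapping.keys (slice m P a) \<Longrightarrow>
     \<mu> \<in> Poly_Mapping.keys P \<and> int m - int (wdeg gen_weight_of \<mu>) = a"
  unfolding slice_def
  by (drule subsetD[OF Poly_Mapping.keys_sum]) (auto split: if_splits)

lemma finite_exponents [simp]: "finite (exponents \<kappa> m)"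
proof -
  have "exponents \<kappa> m \<subseteq> {\<lceil>- ((real \<kappa> - 1) / real \<kappa>) * real m\<rceil>..int m}"
    by (auto simp: exponents_def ceiling_le_iff)
  then show ?thesis
    by (rule finite_subset) simp
qed

text \<open>The reason why (f_1')^m clears every denominator of the expansion.\<close>

lemma exponents_ge:
  assumes "1 \<le> \<kappa>" "a \<in> exponents \<kappa> m"
  shows "0 \<le> a + int m"
proof -
  have "(real \<kappa> - 1) / real \<kappa> * real m \<le> 1 * real m"
    by (rule mult_right_mono) (use assms(1) in auto)
  then have "- real m \<le> real_of_int a"
    using assms(2) by (simp add: exponents_def)
  then show ?thesis
    by linarith
qed

text \<open>The lower bound on the exponents comes from \<open>2l - 1 \<le> (2 - 1 / \<kappa>) l\<close> for \<open>l \<le> \<kappa>\<close>.\<close>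

lemma exponent_in_exponents:
  assumes \<kappa>: "1 \<le> \<kappa>" and P: "P \<in> invariants n \<kappa> m" and \<mu>: "\<mu> \<in> Poly_Mapping.keys P"
  shows "int m - int (wdeg gen_weight_of \<mu>) \<in> exponents \<kappa> m"
proof -
  have "Poly_Mapping.keys \<mu> \<subseteq> jet_vars n \<kappa>"
    using invariants_in_jet_ring[OF P] \<mu> by (auto simp: jet_ring_eq polys_over_def)
  then have le: "\<kappa> * gen_weight_of v \<le> (2 * \<kappa> - 1) * jet_order v" if "v \<in> Poly_Mapping.keys \<mu>" for v
    using that \<kappa> by (auto simp: jet_vars_def gen_weight_of_def diff_mult_distrib diff_mult_distrib2)
  have "\<kappa> * wdeg gen_weight_of \<mu> = (\<Sum>v\<in>Poly_Mapping.keys \<mu>. \<kappa> * gen_weight_of v * Poly_Mapping.lookup \<mu> v)"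
    by (simp add: wdeg_def sum_distrib_left mult_ac)
  also have "\<dots> \<le> (\<Sum>v\<in>Poly_Mapping.keys \<mu>. (2 * \<kappa> - 1) * jet_order v * Poly_Mapping.lookup \<mu> v)"
    by (intro sum_mono mult_right_mono le) auto
  also have "\<dots> = (2 * \<kappa> - 1) * wdeg jet_order \<mu>"
    by (simp add: wdeg_def sum_distrib_left mult_ac)
  also have "\<dots> = (2 * \<kappa> - 1) * m"
    by (simp add: invariants_isobaric[OF \<kappa> P \<mu>])
  finally have "real (\<kappa> * wdeg gen_weight_of \<mu>) \<le> real ((2 * \<kappa> - 1) * m)"
    by (rule of_nat_mono)
  then have "real \<kappa> * real (wdeg gen_weight_of \<mu>) \<le> (2 * real \<kappa> - 1) * real m"
    using \<kappa> by (simp add: of_nat_diff)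
  then have "- ((real \<kappa> - 1) / real \<kappa>) * real m \<le> real m - real (wdeg gen_weight_of \<mu>)"
    using \<kappa> by (simp add: field_simps)
  then show ?thesis
    by (simp add: exponents_def)
qed

lemma sum_slice:
  assumes "1 \<le> \<kappa>" "P \<in> invariants n \<kappa> m"
  shows "P = (\<Sum>a\<in>exponents \<kappa> m. slice m P a)"
proof -
  have "(\<Sum>a\<in>exponents \<kappa> m. slice m P a) =
      (\<Sum>\<mu>\<in>Poly_Mapping.keys P. Poly_Mapping.single \<mu> (Poly_Mapping.lookup P \<mu>))"
    unfolding slice_def
    by (rule sum.group) (use exponent_in_exponents[OF assms] in auto)
  then show ?thesis
    using poly_eq_sum_single[of P, symmetric] by (simp only:)
qed

lemma slice_in_jet_ring:
  assumes "P \<in> jet_ring n \<kappa>"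
  shows "slice m P a \<in> jet_ring n \<kappa>"
  using assms keys_slice unfolding jet_ring_eq polys_over_def by blast

text \<open>\<open>gen_of v\<close> is homogeneous of weight \<open>gen_weight_of v\<close>, and by
  construction the monomials of a slice all have the same total m - a of these weights.\<close>

lemma admissible_slices:
  assumes P: "P \<in> jet_ring n \<kappa>"
  shows "admissible n \<kappa> m (\<lambda>a. subst gen_of (slice m P a))"
  unfolding admissible_def
proof (intro ballI conjI)
  fix a
  have S: "slice m P a \<in> polys_over (jet_vars n \<kappa>)"
    using slice_in_jet_ring[OF P] by (simp add: jet_ring_eq)
  show "subst gen_of (slice m P a) \<in> gen_ring n \<kappa>"
    unfolding gen_ring_def
    by (rule polys_over_subst[OF S]) (auto simp: jet_vars_def gen_of_def intro!: polys_over_Var)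
  show "weighted_homogeneous (nat (int m - a)) (subst gen_of (slice m P a))"
    unfolding weighted_homogeneous_def
  proof
    fix \<delta>
    have "subst (\<lambda>v. Const (\<delta> ^ gen_weight v) * Var v) (subst gen_of (slice m P a)) =
        subst (\<lambda>v. Const \<delta> ^ gen_weight_of v * gen_of v) (slice m P a)"
      unfolding Const_hom.subst_with_subst
    proof (rule Const_hom.subst_with_cong[OF S])
      fix v assume "v \<in> jet_vars n \<kappa>"
      then obtain i l where v: "v = Jet i l" "1 \<le> l"
        by (auto simp: jet_vars_def)
      show "subst (\<lambda>v. Const (\<delta> ^ gen_weight v) * Var v) (gen_of v) = Const \<delta> ^ gen_weight_of v * gen_of v"
      proof (cases "i = 1 \<or> l = 1")
        case True
        then show ?thesis
          by (auto simp: v gen_of_def gen_weight_of_def Const_power Const_hom.subst_with_0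
              Const_hom.subst_with_1 Const_hom.subst_with_Var)
      next
        case False
        then have "2 \<le> l"
          using v(2) by simp
        then have "2 * (l - 2) + 3 = 2 * l - 1"
          by simp
        then show ?thesis
          using False by (simp add: v gen_of_def gen_weight_of_def Const_power Const_hom.subst_with_Var)
      qed
    qed
    also have "\<dots> = Const \<delta> ^ nat (int m - a) * subst gen_of (slice m P a)"
      by (rule Const_hom.subst_with_scale) (use keys_slice in fastforce)
    finally show "subst (\<lambda>v. Const (\<delta> ^ gen_weight v) * Var v) (subst gen_of (slice m P a)) =
        Const (\<delta> ^ nat (int m - a)) * subst gen_of (slice m P a)"
      by (simp add: Const_power)
  qed
qed

section \<open>Clearing denominators and the two directions of the theorem\<close>

lemma to_fract_power: "to_fract (x ^ k) = to_fract x ^ k"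
  by (induction k) simp_all

lemma power_mult_expansion:
  assumes "1 \<le> \<kappa>"
  shows "to_fract (jet 1 1 ^ m) * expansion n \<kappa> m Pa =
    to_fract (\<Sum>a\<in>exponents \<kappa> m. jet 1 1 ^ nat (a + int m) * subst (gen_value n) (Pa a))"
proof -
  have nz: "to_fract (jet 1 1) \<noteq> 0"
    unfolding to_fract_eq_0_iff by (rule Var_neq_0)
  have "to_fract (jet 1 1 ^ m) * (to_fract (jet 1 1) powi a * E) =
      to_fract (jet 1 1 ^ nat (a + int m)) * E" if "a \<in> exponents \<kappa> m" for a E
  proof -
    have "to_fract (jet 1 1) powi (a + int m) = to_fract (jet 1 1) powi a * to_fract (jet 1 1) ^ m"
      using nz by (simp add: power_int_add)
    moreover have "to_fract (jet 1 1) powi (a + int m) = to_fract (jet 1 1) ^ nat (a + int m)"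
      using exponents_ge[OF assms that] by (simp add: power_int_def)
    ultimately show ?thesis
      unfolding to_fract_power by (simp only: mult_ac)
  qed
  then show ?thesis
    unfolding expansion_def to_fract_sum to_fract_mult sum_distrib_left by (rule sum.cong[OF refl])
qed

text \<open>Each normalized coordinate is a power of 1/f_1' times the value of its generator; across
  a slice these powers add up to the constant exponent m - a.\<close>

lemma eval_normalized_slice:
  assumes P: "P \<in> jet_ring n \<kappa>"
  shows "eval_at (normalized_point n x) (slice m P a) =
    inverse (x (Jet 1 1)) ^ nat (int m - a) * eval_at x (subst (gen_value n) (subst gen_of (slice m P a)))"
proof -
  have S: "slice m P a \<in> polys_over (jet_vars n \<kappa>)"
    using slice_in_jet_ring[OF P] by (simp add: jet_ring_eq)
  let ?g = "\<lambda>v. eval_at (\<lambda>w. eval_at x (gen_value n w)) (gen_of v)"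
  have "eval_at (normalized_point n x) (slice m P a) =
      eval_at (\<lambda>v. inverse (x (Jet 1 1)) ^ gen_weight_of v * ?g v) (slice m P a)"
  proof (rule eval_hom.subst_with_cong[OF S])
    fix v assume "v \<in> jet_vars n \<kappa>"
    then obtain i l where v: "v = Jet i l" "1 \<le> l"
      by (auto simp: jet_vars_def)
    then show "normalized_point n x v = inverse (x (Jet 1 1)) ^ gen_weight_of v * ?g v"
      by (auto simp: normalized_point_def gen_weight_of_def gen_of_def eval_at_simps)
  qed
  also have "\<dots> = inverse (x (Jet 1 1)) ^ nat (int m - a) * eval_at ?g (slice m P a)"
    by (rule eval_hom.subst_with_scale) (use keys_slice in fastforce)
  also have "eval_at ?g (slice m P a) = eval_at x (subst (gen_value n) (subst gen_of (slice m P a)))"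
    by (simp only: eval_hom.subst_with_subst)
  finally show ?thesis .
qed

lemma expansion_of_invariant:
  assumes n: "1 \<le> n" and \<kappa>: "1 \<le> \<kappa>" and P: "P \<in> invariants n \<kappa> m"
  shows "to_fract P = expansion n \<kappa> m (\<lambda>a. subst gen_of (slice m P a))"
proof -
  let ?E = "\<lambda>a. subst (gen_value n) (subst gen_of (slice m P a))"
  have "jet 1 1 ^ m * P = (\<Sum>a\<in>exponents \<kappa> m. jet 1 1 ^ nat (a + int m) * ?E a)"
  proof (rule poly_eqI_generic)
    fix x :: "jet_var \<Rightarrow> complex"
    let ?x = "x (Jet 1 1)"
    assume x: "?x \<noteq> 0"
    \<comment> \<open>One factor \<open>?x ^ m\<close> clears denominators, the other comes from the
      weight of P.\<close>
    have "eval_at x (jet 1 1 ^ m * P) = ?x ^ m * (?x ^ m * eval_at (normalized_point n x) P)"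
      unfolding eval_at_simps eval_invariant_normalized[where x = x, OF n \<kappa> P x] ..
    also have "eval_at (normalized_point n x) P =
        eval_at (normalized_point n x) (\<Sum>a\<in>exponents \<kappa> m. slice m P a)"
      by (rule arg_cong[OF sum_slice[OF \<kappa> P]])
    also have "\<dots> = (\<Sum>a\<in>exponents \<kappa> m. inverse ?x ^ nat (int m - a) * eval_at x (?E a))"
      by (simp only: eval_hom.subst_with_sum eval_normalized_slice[OF invariants_in_jet_ring[OF P]])
    \<comment> \<open>Exponent count: 2m - (m - a) = a + m, nonnegative by
      \<open>exponents_ge\<close>.\<close>
    also have "?x ^ m * (?x ^ m * \<dots>) = (\<Sum>a\<in>exponents \<kappa> m. ?x ^ nat (a + int m) * eval_at x (?E a))"
      unfolding sum_distrib_left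
    proof (rule sum.cong[OF refl])
      fix a assume a: "a \<in> exponents \<kappa> m"
      have "nat (a + int m) + nat (int m - a) = m + m"
        using a exponents_ge[OF \<kappa> a] by (auto simp: exponents_def)
      then have "?x ^ m * ?x ^ m = ?x ^ nat (a + int m) * ?x ^ nat (int m - a)"
        by (metis power_add)
      then show "?x ^ m * (?x ^ m * (inverse ?x ^ nat (int m - a) * eval_at x (?E a))) =
          ?x ^ nat (a + int m) * eval_at x (?E a)"
        using x by (simp add: power_inverse mult.assoc[symmetric])
    qed
    finally show "eval_at x (jet 1 1 ^ m * P) =
        eval_at x (\<Sum>a\<in>exponents \<kappa> m. jet 1 1 ^ nat (a + int m) * ?E a)"
      by (simp only: eval_at_simps)
  qed
  then have "to_fract (jet 1 1 ^ m) * to_fract P =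
      to_fract (jet 1 1 ^ m) * expansion n \<kappa> m (\<lambda>a. subst gen_of (slice m P a))"
    unfolding power_mult_expansion[OF \<kappa>] to_fract_mult[symmetric] by (rule arg_cong)
  moreover have "to_fract (jet 1 1) ^ m \<noteq> 0"
    by (rule power_not_zero) (simp only: to_fract_eq_0_iff Var_neq_0 not_False_eq_True)
  ultimately show ?thesis
    unfolding to_fract_power by (rule mult_left_cancel[THEN iffD1, rotated])
qed

text \<open>After multiplication by (f_1')^m each term is a product of invariants of weights a + m
  and m - a, so the sum is invariant of weight 2m; cancelling (f_1')^m brings the weight back to
  m.\<close>

lemma invariant_of_expansion:
  assumes n: "1 \<le> n" and \<kappa>: "1 \<le> \<kappa>" and adm: "admissible n \<kappa> m Pa"
    and R: "R \<in> jet_ring n \<kappa>" and eq: "to_fract R = expansion n \<kappa> m Pa"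
  shows "R \<in> invariants n \<kappa> m"
proof (rule invariants_cancel_power[OF n \<kappa> R])
  have "to_fract (jet 1 1 ^ m * R) =
      to_fract (\<Sum>a\<in>exponents \<kappa> m. jet 1 1 ^ nat (a + int m) * subst (gen_value n) (Pa a))"
    unfolding to_fract_mult eq by (rule power_mult_expansion[OF \<kappa>])
  then have "jet 1 1 ^ m * R = (\<Sum>a\<in>exponents \<kappa> m. jet 1 1 ^ nat (a + int m) * subst (gen_value n) (Pa a))"
    unfolding to_fract_eq_iff .
  moreover have "jet 1 1 ^ nat (a + int m) * subst (gen_value n) (Pa a) \<in> invariants n \<kappa> (m + m)"
    if a: "a \<in> exponents \<kappa> m" for a
  proof -
    have jet: "jet i 1 \<in> invariants n \<kappa> 1" if "i \<in> {1..n}" for i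
      using \<kappa> by (intro invariants_mono[OF _ jet_in_invariants[OF that]]) simp
    have Lambda: "Lambda n i r \<in> invariants n \<kappa> (2 * r + 3)" if "i \<in> {2..n}" "r + 2 \<le> \<kappa>" for i r
      by (rule invariants_mono[OF that(2) Lambda_in_invariants]) (use that(1) in auto)
    have Pa: "Pa a \<in> gen_ring n \<kappa>" "weighted_homogeneous (nat (int m - a)) (Pa a)"
      using adm a by (auto simp: admissible_def)
    have "subst (gen_value n) (Pa a) \<in> invariants n \<kappa> (nat (int m - a))"
    proof (rule subst_in_invariants[OF Pa(1)[unfolded gen_ring_def]])
      fix v assume "v \<in> {F i |i. i \<in> {2..n}} \<union> {A i r |i r. i \<in> {2..n} \<and> r + 2 \<le> \<kappa>}"
      then show "gen_value n v \<in> invariants n \<kappa> (gen_weight v)"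
        using jet Lambda by auto
    qed (use Pa(2) in \<open>simp add: weighted_homogeneous_def\<close>)
    moreover have "jet 1 1 ^ nat (a + int m) \<in> invariants n \<kappa> (nat (a + int m) * 1)"
      using n by (intro power_in_invariants jet) simp
    moreover have "nat (a + int m) * 1 + nat (int m - a) = m + m"
      using a exponents_ge[OF \<kappa> a] by (auto simp: exponents_def)
    ultimately show ?thesis
      using mult_in_invariants by metis
  qed
  ultimately show "jet 1 1 ^ m * R \<in> invariants n \<kappa> (m + m)"
    by (simp only:) (rule sum_in_invariants)
qed

theorem mainTheorem5:
  fixes n \<kappa> m :: nat
  assumes "n \<ge> 1" and "\<kappa> \<ge> 1"
  shows "(\<forall>P \<in> invariants n \<kappa> m.
            \<exists>Pa. admissible n \<kappa> m Pa \<and> to_fract P = expansion n \<kappa> m Pa) \<and>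
         (\<forall>Pa R. admissible n \<kappa> m Pa \<longrightarrow> R \<in> jet_ring n \<kappa> \<longrightarrow>
            to_fract R = expansion n \<kappa> m Pa \<longrightarrow> R \<in> invariants n \<kappa> m)"
  using admissible_slices[OF invariants_in_jet_ring] expansion_of_invariant[OF assms]
    invariant_of_expansion[OF assms] by blast

end
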